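(* Let $(M^4,g)$ be a mixed quasi-Einstein spacetime $M(QE)_4$ satisfying $H\cdot S=0$, where $H$ is the conharmonic curvature tensor and $S$ the Ricci tensor. Then the scalar curvature of $(M,g)$ is $0$.
   Context: $R(X,Y)Z$ is the Riemann curvature, $\tilde R(X,Y,Z,W)=g(R(X,Y)Z,W)$, $S$ the Ricci tensor. The sign convention is the one in which constant curvature $c$ means $R(X,Y)Z=c[g(Y,Z)X-g(X,Z)Y]$, and $S(Y,Z)=\mathrm{trace}(X\mapsto R(X,Y)Z)$. A mixed quasi-Einstein spacetime $M(QE)_4$ is a non-flat 4-dimensional Lorentzian manifold with $S(X,Y)=\alpha g(X,Y)+\beta[A(X)B(Y)+A(Y)B(X)]$, where $\alpha,\beta$ are scalar functions, $\beta$ nowhere zero, $A(X)=g(X,\xi_1)$, $B(X)=g(X,\xi_2)$, $g(\xi_1,\xi_1)=-1$, $g(\xi_2,\xi_2)=1$, $g(\xi_1,\xi_2)=0$. The conharmonic curvature tensor ($n=4$) is $$H(X,Y,Z,W)=\tilde R(X,Y,Z,W)-\tfrac12[g(X,W)S(Y,Z)-g(X,Z)S(Y,W)+g(Y,Z)S(X,W)-g(Y,W)S(X,Z)],$$ and $g(H(X,Y)Z,W)=H(X,Y,Z,W)$. The condition $H\cdot S=0$ means $S(H(X,Y)Z,W)+S(Z,H(X,Y)W)=0$ for all vector fields $X,Y,Z,W$. *)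

theory Defs
  imports "HOL-Analysis.Analysis"
begin

section \<open>Smooth functions and manifolds\<close>

fun Ck_on :: "nat \<Rightarrow> (real^'n) set \<Rightarrow> (real^'n \<Rightarrow> real) \<Rightarrow> bool" where
  "Ck_on 0 U f \<longleftrightarrow> continuous_on U f"
| "Ck_on (Suc k) U f \<longleftrightarrow> f differentiable_on U \<and>
     (\<forall>i. Ck_on k U (\<lambda>x. frechet_derivative f (at x) (axis i 1)))"

definition smooth_on :: "(real^'n) set \<Rightarrow> (real^'n \<Rightarrow> real) \<Rightarrow> bool" where
  "smooth_on U f \<longleftrightarrow> (\<forall>k. Ck_on k U f)"

text \<open>A chart is a pair of a domain and a coordinate map; the values of the coordinate map
  outside the domain are irrelevant.\<close>

type_synonym ('a, 'n) chart = "'a set \<times> ('a \<Rightarrow> real^'n)"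

abbreviation cdom :: "('a, 'n::finite) chart \<Rightarrow> 'a set" where
  "cdom c \<equiv> fst c"

abbreviation cmap :: "('a, 'n::finite) chart \<Rightarrow> 'a \<Rightarrow> real^'n" where
  "cmap c \<equiv> snd c"

definition cinv :: "('a, 'n::finite) chart \<Rightarrow> real^'n \<Rightarrow> 'a" where
  "cinv c = inv_into (cdom c) (cmap c)"

definition chart_on :: "'a topology \<Rightarrow> ('a, 'n::finite) chart \<Rightarrow> bool" where
  "chart_on M c \<longleftrightarrow> openin M (cdom c) \<and> open (cmap c ` cdom c) \<and>
     homeomorphic_map (subtopology M (cdom c)) (top_of_set (cmap c ` cdom c)) (cmap c)"

definition transition :: "('a, 'n::finite) chart \<Rightarrow> ('a, 'n::finite) chart \<Rightarrow> real^'n \<Rightarrow> real^'n" where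
  "transition c d = cmap d \<circ> cinv c"

definition smooth_manifold :: "'a topology \<Rightarrow> ('a, 'n::finite) chart set \<Rightarrow> bool" where
  "smooth_manifold M \<A> \<longleftrightarrow>
     Hausdorff_space M \<and> second_countable M \<and>
     (\<forall>c\<in>\<A>. chart_on M c) \<and> (\<Union>c\<in>\<A>. cdom c) = topspace M \<and>
     (\<forall>c\<in>\<A>. \<forall>d\<in>\<A>. \<forall>i. smooth_on (cmap c ` (cdom c \<inter> cdom d)) (\<lambda>x. transition c d x $ i))"

definition smooth_in_chart :: "('a, 'n::finite) chart \<Rightarrow> ('a \<Rightarrow> real) \<Rightarrow> bool" where
  "smooth_in_chart c f \<longleftrightarrow> smooth_on (cmap c ` cdom c) (f \<circ> cinv c)"

definition transition_jacobian :: "('a, 'n::finite) chart \<Rightarrow> ('a, 'n::finite) chart \<Rightarrow> 'a \<Rightarrow> real^'n^'n" where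
  "transition_jacobian c d p = jacobian (transition c d) (at (cmap c p))"

section \<open>Vector fields and metrics\<close>

text \<open>A vector field is given by its component vector \<open>X c p\<close> in every chart \<open>c\<close> of the atlas at
  every point \<open>p\<close> of the domain of \<open>c\<close>, subject to the transformation law under change of charts;
  a metric is likewise given by its component matrices \<open>g c p\<close>.\<close>

definition vector_field ::
  "('a, 'n::finite) chart set \<Rightarrow> (('a, 'n::finite) chart \<Rightarrow> 'a \<Rightarrow> real^'n) \<Rightarrow> bool" where
  "vector_field \<A> X \<longleftrightarrow>
     (\<forall>c\<in>\<A>. \<forall>i. smooth_in_chart c (\<lambda>p. X c p $ i)) \<and>
     (\<forall>c\<in>\<A>. \<forall>d\<in>\<A>. \<forall>p\<in>cdom c \<inter> cdom d. X d p = transition_jacobian c d p *v X c p)"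

definition lorentzian_matrix :: "real^'n^'n \<Rightarrow> bool" where
  "lorentzian_matrix G \<longleftrightarrow> transpose G = G \<and>
     (\<exists>(P :: real^'n^'n) i\<^sub>0. invertible P \<and>
        transpose P ** G ** P = (\<chi> i j. if i = j then (if i = i\<^sub>0 then - 1 else 1) else 0))"

definition lorentzian_metric ::
  "('a, 'n::finite) chart set \<Rightarrow> (('a, 'n::finite) chart \<Rightarrow> 'a \<Rightarrow> real^'n^'n) \<Rightarrow> bool" where
  "lorentzian_metric \<A> g \<longleftrightarrow>
     (\<forall>c\<in>\<A>. \<forall>i j. smooth_in_chart c (\<lambda>p. g c p $ i $ j)) \<and>
     (\<forall>c\<in>\<A>. \<forall>p\<in>cdom c. lorentzian_matrix (g c p)) \<and>
     (\<forall>c\<in>\<A>. \<forall>d\<in>\<A>. \<forall>p\<in>cdom c \<inter> cdom d.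
        g c p = transpose (transition_jacobian c d p) ** g d p ** transition_jacobian c d p)"

definition lorentzian_manifold ::
  "'a topology \<Rightarrow> ('a, 'n::finite) chart set \<Rightarrow> (('a, 'n::finite) chart \<Rightarrow> 'a \<Rightarrow> real^'n^'n) \<Rightarrow> bool" where
  "lorentzian_manifold M \<A> g \<longleftrightarrow> smooth_manifold M \<A> \<and> lorentzian_metric \<A> g"

section \<open>Curvature in a chart\<close>

text \<open>From here on \<open>G\<close> is the component matrix of the metric in a fixed chart \<open>c\<close>, and vectors and
  vector fields are given by their components in \<open>c\<close>.\<close>

definition metric :: "('a \<Rightarrow> real^'n^'n) \<Rightarrow> 'a \<Rightarrow> real^'n \<Rightarrow> real^'n \<Rightarrow> real" where
  "metric G p u v = (\<Sum>i\<in>UNIV. \<Sum>j\<in>UNIV. G p $ i $ j * u $ i * v $ j)"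

definition pderiv_chart :: "('a, 'n::finite) chart \<Rightarrow> 'n \<Rightarrow> ('a \<Rightarrow> real) \<Rightarrow> 'a \<Rightarrow> real" where
  "pderiv_chart c i f p = frechet_derivative (f \<circ> cinv c) (at (cmap c p)) (axis i 1)"

text \<open>\<open>christoffel c G k i j\<close> is the Christoffel symbol of the second kind with upper index \<open>k\<close>.\<close>

definition christoffel ::
  "('a, 'n::finite) chart \<Rightarrow> ('a \<Rightarrow> real^'n^'n) \<Rightarrow> 'n \<Rightarrow> 'n \<Rightarrow> 'n \<Rightarrow> 'a \<Rightarrow> real" where
  "christoffel c G k i j p = 1/2 * (\<Sum>l\<in>UNIV. matrix_inv (G p) $ k $ l *
     (pderiv_chart c i (\<lambda>q. G q $ j $ l) p + pderiv_chart c j (\<lambda>q. G q $ i $ l) p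
      - pderiv_chart c l (\<lambda>q. G q $ i $ j) p))"

text \<open>The Levi-Civita connection.\<close>

definition cov_deriv ::
  "('a, 'n::finite) chart \<Rightarrow> ('a \<Rightarrow> real^'n^'n) \<Rightarrow> ('a \<Rightarrow> real^'n) \<Rightarrow> ('a \<Rightarrow> real^'n) \<Rightarrow> 'a \<Rightarrow> real^'n" where
  "cov_deriv c G X Y p = (\<chi> k.
     (\<Sum>i\<in>UNIV. X p $ i * pderiv_chart c i (\<lambda>q. Y q $ k) p) +
     (\<Sum>i\<in>UNIV. \<Sum>j\<in>UNIV. christoffel c G k i j p * X p $ i * Y p $ j))"

definition lie_bracket ::
  "('a, 'n::finite) chart \<Rightarrow> ('a \<Rightarrow> real^'n) \<Rightarrow> ('a \<Rightarrow> real^'n) \<Rightarrow> 'a \<Rightarrow> real^'n" where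
  "lie_bracket c X Y p = (\<chi> k. \<Sum>i\<in>UNIV.
     X p $ i * pderiv_chart c i (\<lambda>q. Y q $ k) p - Y p $ i * pderiv_chart c i (\<lambda>q. X q $ k) p)"

definition curvature_operator ::
  "('a, 'n::finite) chart \<Rightarrow> ('a \<Rightarrow> real^'n^'n) \<Rightarrow> ('a \<Rightarrow> real^'n) \<Rightarrow> ('a \<Rightarrow> real^'n) \<Rightarrow> ('a \<Rightarrow> real^'n) \<Rightarrow>
   'a \<Rightarrow> real^'n" where
  "curvature_operator c G X Y Z p =
     cov_deriv c G X (cov_deriv c G Y Z) p - cov_deriv c G Y (cov_deriv c G X Z) p
     - cov_deriv c G (lie_bracket c X Y) Z p"

text \<open>The curvature tensor at a point: as the curvature operator is tensorial, tangent vectors may be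
  extended to the fields with constant components in the chart.\<close>

definition riemann ::
  "('a, 'n::finite) chart \<Rightarrow> ('a \<Rightarrow> real^'n^'n) \<Rightarrow> 'a \<Rightarrow> real^'n \<Rightarrow> real^'n \<Rightarrow> real^'n \<Rightarrow> real^'n" where
  "riemann c G p u v w = curvature_operator c G (\<lambda>_. u) (\<lambda>_. v) (\<lambda>_. w) p"

definition riemann4 ::
  "('a, 'n::finite) chart \<Rightarrow> ('a \<Rightarrow> real^'n^'n) \<Rightarrow> 'a \<Rightarrow> real^'n \<Rightarrow> real^'n \<Rightarrow> real^'n \<Rightarrow> real^'n \<Rightarrow> real" where
  "riemann4 c G p u v w z = metric G p (riemann c G p u v w) z"

definition ricci ::
  "('a, 'n::finite) chart \<Rightarrow> ('a \<Rightarrow> real^'n^'n) \<Rightarrow> 'a \<Rightarrow> real^'n \<Rightarrow> real^'n \<Rightarrow> real" where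
  "ricci c G p v w = trace (matrix (\<lambda>u. riemann c G p u v w))"

definition scalar_curvature :: "('a, 'n::finite) chart \<Rightarrow> ('a \<Rightarrow> real^'n^'n) \<Rightarrow> 'a \<Rightarrow> real" where
  "scalar_curvature c G p =
     (\<Sum>i\<in>UNIV. \<Sum>j\<in>UNIV. matrix_inv (G p) $ i $ j * ricci c G p (axis i 1) (axis j 1))"

definition flat ::
  "('a, 'n::finite) chart set \<Rightarrow> (('a, 'n::finite) chart \<Rightarrow> 'a \<Rightarrow> real^'n^'n) \<Rightarrow> bool" where
  "flat \<A> g \<longleftrightarrow> (\<forall>c\<in>\<A>. \<forall>p\<in>cdom c. \<forall>u v w. riemann c (g c) p u v w = 0)"

definition conharmonic4 ::
  "('a, 4) chart \<Rightarrow> ('a \<Rightarrow> real^4^4) \<Rightarrow> 'a \<Rightarrow> real^4 \<Rightarrow> real^4 \<Rightarrow> real^4 \<Rightarrow> real^4 \<Rightarrow> real" where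
  "conharmonic4 c G p x y z w = riemann4 c G p x y z w - 1/2 *
     (metric G p x w * ricci c G p y z - metric G p x z * ricci c G p y w
      + metric G p y z * ricci c G p x w - metric G p y w * ricci c G p x z)"

definition conharmonic ::
  "('a, 4) chart \<Rightarrow> ('a \<Rightarrow> real^4^4) \<Rightarrow> 'a \<Rightarrow> real^4 \<Rightarrow> real^4 \<Rightarrow> real^4 \<Rightarrow> real^4" where
  "conharmonic c G p x y z = (THE h. \<forall>w. metric G p h w = conharmonic4 c G p x y z w)"

section \<open>Mixed quasi-Einstein spacetimes\<close>

definition mixed_quasi_einstein_spacetime ::
  "'a topology \<Rightarrow> ('a, 4) chart set \<Rightarrow> (('a, 4) chart \<Rightarrow> 'a \<Rightarrow> real^4^4) \<Rightarrow> bool" where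
  "mixed_quasi_einstein_spacetime M \<A> g \<longleftrightarrow>
     lorentzian_manifold M \<A> g \<and> \<not> flat \<A> g \<and>
     (\<exists>(\<alpha> :: 'a \<Rightarrow> real) (\<beta> :: 'a \<Rightarrow> real) \<xi>\<^sub>1 \<xi>\<^sub>2.
        (\<forall>p\<in>topspace M. \<beta> p \<noteq> 0) \<and>
        vector_field \<A> \<xi>\<^sub>1 \<and> vector_field \<A> \<xi>\<^sub>2 \<and>
        (\<forall>c\<in>\<A>. \<forall>p\<in>cdom c.
           metric (g c) p (\<xi>\<^sub>1 c p) (\<xi>\<^sub>1 c p) = - 1 \<and>
           metric (g c) p (\<xi>\<^sub>2 c p) (\<xi>\<^sub>2 c p) = 1 \<and>
           metric (g c) p (\<xi>\<^sub>1 c p) (\<xi>\<^sub>2 c p) = 0) \<and>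
        (\<forall>X Y. vector_field \<A> X \<longrightarrow> vector_field \<A> Y \<longrightarrow>
           (\<forall>c\<in>\<A>. \<forall>p\<in>cdom c.
              (let A = (\<lambda>v. metric (g c) p v (\<xi>\<^sub>1 c p)); B = (\<lambda>v. metric (g c) p v (\<xi>\<^sub>2 c p)) in
                ricci c (g c) p (X c p) (Y c p) =
                  \<alpha> p * metric (g c) p (X c p) (Y c p) +
                  \<beta> p * (A (X c p) * B (Y c p) + A (Y c p) * B (X c p))))))"

definition conharmonic_dot_ricci_zero ::
  "('a, 4) chart set \<Rightarrow> (('a, 4) chart \<Rightarrow> 'a \<Rightarrow> real^4^4) \<Rightarrow> bool" where
  "conharmonic_dot_ricci_zero \<A> g \<longleftrightarrow>
     (\<forall>X Y Z W. vector_field \<A> X \<longrightarrow> vector_field \<A> Y \<longrightarrow> vector_field \<A> Z \<longrightarrow> vector_field \<A> W \<longrightarrow>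
        (\<forall>c\<in>\<A>. \<forall>p\<in>cdom c.
           ricci c (g c) p (conharmonic c (g c) p (X c p) (Y c p) (Z c p)) (W c p) +
           ricci c (g c) p (Z c p) (conharmonic c (g c) p (X c p) (Y c p) (W c p)) = 0))"

end

theory Submission
  imports Defs
begin

text \<open>Every tangent vector extends to a global vector field, so both hypotheses hold for arbitrary
  tangent vectors at a point. As \<open>H\<close> is skew in its last two arguments, the \<open>\<alpha> g\<close> part of
  \<open>H \<cdot> S = 0\<close> drops out and, since \<open>\<beta> \<noteq> 0\<close>,
  \<open>H(X,Y,Z,\<xi>\<^sub>1) B(W) + A(W) H(X,Y,Z,\<xi>\<^sub>2) + A(Z) H(X,Y,W,\<xi>\<^sub>2) + H(X,Y,W,\<xi>\<^sub>1) B(Z) = 0\<close>.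
  Taking \<open>Z = W = \<xi>\<^sub>1\<close> gives \<open>H(X,Y,\<xi>\<^sub>1,\<xi>\<^sub>2) = 0\<close>, and then \<open>Z = \<xi>\<^sub>1\<close> gives
  \<open>H(X,Y,W,\<xi>\<^sub>2) = 0\<close> for all \<open>X, Y, W\<close>. But contracting \<open>H(X,Y,Z,W)\<close> over \<open>X\<close> and \<open>W\<close> yields
  \<open>- r/2 g(Y,Z)\<close>, where \<open>r = 4 \<alpha>\<close> is the scalar curvature; at \<open>Y = Z = \<xi>\<^sub>2\<close> this forces \<open>r = 0\<close>.\<close>

section \<open>Calculus of \<open>C\<^sup>k\<close> functions\<close>

text \<open>On an open set the derivative at a point depends only on nearby values, so the recursion
  in \<open>Ck_on\<close> respects equality on \<open>U\<close> alone. This allows derivative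
  formulas that are known only inside \<open>U\<close> to be substituted below.\<close>

lemma Ck_on_cong:
  assumes "open U" "\<And>x. x \<in> U \<Longrightarrow> f x = g x" "Ck_on k U f"
  shows "Ck_on k U g"
  using assms(2,3)
proof (induction k arbitrary: f g)
  case 0
  then show ?case using continuous_on_cong by force
next
  case (Suc k)
  have d: "frechet_derivative f (at x) = frechet_derivative g (at x)" "g differentiable at x"
    if "x \<in> U" for x
  proof -
    have "f differentiable at x"
      using Suc.prems \<open>open U\<close> that by (auto simp: differentiable_on_eq_differentiable_at)
    then have "(f has_derivative frechet_derivative f (at x)) (at x)"
      by (simp add: frechet_derivative_works)
    then have *: "(g has_derivative frechet_derivative f (at x)) (at x)"
      using has_derivative_transform_within_open \<open>open U\<close> that Suc.prems(1) by blast
    then show "frechet_derivative f (at x) = frechet_derivative g (at x)"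
      by (rule frechet_derivative_at)
    show "g differentiable at x" using * differentiable_def by blast
  qed
  have "Ck_on k U (\<lambda>x. frechet_derivative g (at x) (axis i 1))" for i
    by (rule Suc.IH[of "\<lambda>x. frechet_derivative f (at x) (axis i 1)"]) (use d Suc.prems in auto)
  then show ?case
    using d \<open>open U\<close> by (auto simp: differentiable_on_eq_differentiable_at)
qed

text \<open>Continuity, differentiability and the value of each partial derivative at a point are
  local notions. The lemma glues the two pieces of a vector field that is extended by zero.\<close>

lemma Ck_on_local:
  assumes "\<And>x. x \<in> U \<Longrightarrow> \<exists>V. open V \<and> x \<in> V \<and> Ck_on k V f"
  shows "Ck_on k U f"
  using assms
proof (induction k arbitrary: f)
  case 0
  have "continuous (at x) f" if "x \<in> U" for x
    using 0[OF that] by (auto simp: continuous_on_eq_continuous_at)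
  then show ?case by (simp add: continuous_at_imp_continuous_on)
next
  case (Suc k)
  have "f differentiable at x" if "x \<in> U" for x
    using Suc.prems[OF that] by (auto simp: differentiable_on_eq_differentiable_at)
  moreover have "Ck_on k U (\<lambda>x. frechet_derivative f (at x) (axis i 1))" for i
    by (rule Suc.IH) (use Suc.prems in force)
  ultimately show ?case
    by (auto simp: differentiable_at_imp_differentiable_on)
qed

lemma Ck_on_SucD: "Ck_on (Suc k) U f \<Longrightarrow> Ck_on k U f"
  by (induction k arbitrary: f) (auto simp: differentiable_imp_continuous_on)

lemma Ck_on_const: "Ck_on k U (\<lambda>x. a)"
  by (induction k arbitrary: a) auto

section \<open>Sums and products of functions of class \<open>Ck_on\<close>\<close>

lemma frechet_derivative_add_real:
  fixes f g :: "'b::real_normed_vector \<Rightarrow> real"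
  assumes "f differentiable at x" "g differentiable at x"
  shows "frechet_derivative (\<lambda>x. f x + g x) (at x) h
    = frechet_derivative f (at x) h + frechet_derivative g (at x) h"
  using frechet_derivative_at[OF has_derivative_add[OF assms[unfolded frechet_derivative_works]]]
  by (metis (no_types, lifting))

lemma frechet_derivative_mult_real:
  fixes f g :: "'b::real_normed_vector \<Rightarrow> real"
  assumes "f differentiable at x" "g differentiable at x"
  shows "frechet_derivative (\<lambda>x. f x * g x) (at x) h
    = f x * frechet_derivative g (at x) h + frechet_derivative f (at x) h * g x"
  using frechet_derivative_at[OF has_derivative_mult[OF assms[unfolded frechet_derivative_works]]]
  by (metis (no_types, lifting))

lemma frechet_derivative_sum_real:
  fixes f :: "'i \<Rightarrow> 'b::real_normed_vector \<Rightarrow> real"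
  assumes "\<And>i. i \<in> I \<Longrightarrow> f i differentiable at x"
  shows "frechet_derivative (\<lambda>x. \<Sum>i\<in>I. f i x) (at x) h
    = (\<Sum>i\<in>I. frechet_derivative (f i) (at x) h)"
proof -
  have "((\<lambda>x. \<Sum>i\<in>I. f i x) has_derivative (\<lambda>h. \<Sum>i\<in>I. frechet_derivative (f i) (at x) h)) (at x)"
    by (rule has_derivative_sum) (use assms frechet_derivative_works in blast)
  from frechet_derivative_at[OF this] show ?thesis by metis
qed

lemma Ck_on_add:
  assumes "open U" "Ck_on k U f" "Ck_on k U g"
  shows "Ck_on k U (\<lambda>x. f x + g x)"
  using assms(2,3)
proof (induction k arbitrary: f g)
  case 0
  then show ?case by (auto intro: continuous_on_add)
next
  case (Suc k)
  have d: "f differentiable at x" "g differentiable at x" if "x \<in> U" for x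
    using Suc.prems that \<open>open U\<close> by (auto simp: differentiable_on_eq_differentiable_at)
  have "Ck_on k U (\<lambda>x. frechet_derivative (\<lambda>x. f x + g x) (at x) (axis i 1))" for i
    by (rule Ck_on_cong[OF \<open>open U\<close> _ Suc.IH[of "\<lambda>x. frechet_derivative f (at x) (axis i 1)"
            "\<lambda>x. frechet_derivative g (at x) (axis i 1)"]])
      (use d Suc.prems in \<open>auto simp: frechet_derivative_add_real\<close>)
  then show ?case using Suc.prems by (auto intro: differentiable_on_add)
qed

lemma Ck_on_sum:
  assumes "open U" "\<And>i. i \<in> I \<Longrightarrow> Ck_on k U (f i)"
  shows "Ck_on k U (\<lambda>x. \<Sum>i\<in>I. f i x)"
  using assms(2)
  by (induction I rule: infinite_finite_induct) (auto intro: Ck_on_const Ck_on_add[OF \<open>open U\<close>])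

lemma Ck_on_mult:
  assumes "open U" "Ck_on k U f" "Ck_on k U g"
  shows "Ck_on k U (\<lambda>x. f x * g x)"
  using assms(2,3)
proof (induction k arbitrary: f g)
  case 0
  then show ?case by (auto intro: continuous_on_mult)
next
  case (Suc k)
  have d: "f differentiable at x" "g differentiable at x" if "x \<in> U" for x
    using Suc.prems that \<open>open U\<close> by (auto simp: differentiable_on_eq_differentiable_at)
  \<comment> \<open>The product rule mixes undifferentiated and differentiated factors, so the
    induction hypothesis is applied to \<open>f\<close> and \<open>g\<close> themselves at order
    \<open>k\<close> as well.\<close>
  have c: "Ck_on k U f" "Ck_on k U g"
    by (rule Ck_on_SucD, rule Suc.prems)+
  have "Ck_on k U (\<lambda>x. frechet_derivative (\<lambda>x. f x * g x) (at x) (axis i 1))" for i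
    by (rule Ck_on_cong[OF \<open>open U\<close> _ Ck_on_add[OF \<open>open U\<close>
            Suc.IH[of f "\<lambda>x. frechet_derivative g (at x) (axis i 1)"]
            Suc.IH[of "\<lambda>x. frechet_derivative f (at x) (axis i 1)" g]]])
      (use d c Suc.prems in \<open>auto simp: frechet_derivative_mult_real\<close>)
  then show ?case using Suc.prems by (auto intro: differentiable_on_mult)
qed

section \<open>Vector-valued maps and the chain rule\<close>

lemma has_derivative_vec_iff:
  fixes f :: "'b::real_normed_vector \<Rightarrow> real^'n"
  shows "(f has_derivative D) (at x) \<longleftrightarrow> (\<forall>i. ((\<lambda>x. f x $ i) has_derivative (\<lambda>h. D h $ i)) (at x))"
  by (subst has_derivative_componentwise_within)
    (auto simp: Basis_vec_def inner_axis axis_eq_axis)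

lemma differentiable_vec_iff:
  fixes f :: "'b::real_normed_vector \<Rightarrow> real^'n"
  shows "f differentiable (at x) \<longleftrightarrow> (\<forall>i. (\<lambda>x. f x $ i) differentiable (at x))"
  by (subst differentiable_componentwise_within)
    (auto simp: Basis_vec_def inner_axis axis_eq_axis)

lemma frechet_derivative_vec_nth:
  fixes f :: "'b::real_normed_vector \<Rightarrow> real^'n"
  assumes "f differentiable (at x)"
  shows "frechet_derivative f (at x) h $ i = frechet_derivative (\<lambda>x. f x $ i) (at x) h"
proof -
  have "((\<lambda>x. f x $ i) has_derivative (\<lambda>h. frechet_derivative f (at x) h $ i)) (at x)"
    using assms has_derivative_vec_iff frechet_derivative_works by blast
  from frechet_derivative_at[OF this] show ?thesis by metis
qed

lemma linear_eq_sum_axis: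
  fixes L :: "real^'n \<Rightarrow> 'b::real_vector"
  assumes "linear L"
  shows "L v = (\<Sum>j\<in>UNIV. v $ j *\<^sub>R L (axis j 1))"
proof -
  have "v = (\<Sum>j\<in>UNIV. v $ j *\<^sub>R axis j 1)"
    by (simp add: vec_eq_iff axis_def if_distrib cong: if_cong)
  then have "L v = L (\<Sum>j\<in>UNIV. v $ j *\<^sub>R axis j 1)" by simp
  also have "\<dots> = (\<Sum>j\<in>UNIV. v $ j *\<^sub>R L (axis j 1))"
    by (simp add: linear_sum[OF assms] linear_cmul[OF assms])
  finally show ?thesis .
qed

lemma frechet_derivative_chain_real:
  fixes f :: "real^'n \<Rightarrow> real" and \<phi> :: "real^'m \<Rightarrow> real^'n"
  assumes "f differentiable at (\<phi> x)" "\<phi> differentiable at x"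
  shows "frechet_derivative (\<lambda>x. f (\<phi> x)) (at x) h
    = (\<Sum>j\<in>UNIV. frechet_derivative (\<lambda>x. \<phi> x $ j) (at x) h * frechet_derivative f (at (\<phi> x)) (axis j 1))"
proof -
  have "frechet_derivative (f \<circ> \<phi>) (at x) h = frechet_derivative f (at (\<phi> x)) (frechet_derivative \<phi> (at x) h)"
    using frechet_derivative_compose[OF assms(2,1)] by simp
  then show ?thesis
    by (simp add: comp_def linear_eq_sum_axis[OF linear_frechet_derivative[OF assms(1)],
          of "frechet_derivative \<phi> (at x) h"] frechet_derivative_vec_nth[OF assms(2)])
qed

text \<open>By the chain rule each partial derivative of the composite is a sum of products: a
  partial derivative of a component of \<open>\<phi>\<close> times a partial derivative of
  \<open>f\<close> composed with \<open>\<phi>\<close>. The latter is again a composite with the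
  same inner map, hence the induction with \<open>f\<close> arbitrary.\<close>

lemma Ck_on_compose:
  fixes f :: "real^'n \<Rightarrow> real" and \<phi> :: "real^'m \<Rightarrow> real^'n"
  assumes "open U" "open V" "\<phi> ` U \<subseteq> V" "\<And>i. Ck_on k U (\<lambda>x. \<phi> x $ i)" "Ck_on k V f"
  shows "Ck_on k U (\<lambda>x. f (\<phi> x))"
  using assms(4,5)
proof (induction k arbitrary: f)
  case 0
  then have "continuous_on U (\<lambda>x. \<chi> i. \<phi> x $ i)"
    by (intro continuous_on_vec_lambda) auto
  then show ?case
    using 0 assms(3) continuous_on_compose2[of V f U \<phi>] by auto
next
  case (Suc k)
  have d: "f differentiable at (\<phi> x)" "\<phi> differentiable at x" if "x \<in> U" for x
    using Suc.prems that assms(1-3)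
    by (auto simp: differentiable_on_eq_differentiable_at differentiable_vec_iff)
  have c: "Ck_on k U (\<lambda>x. \<phi> x $ i)" for i
    using Suc.prems(1) by (rule Ck_on_SucD)
  have "Ck_on k U (\<lambda>x. frechet_derivative (\<lambda>x. f (\<phi> x)) (at x) (axis i 1))" for i
    by (rule Ck_on_cong[OF \<open>open U\<close> _ Ck_on_sum[OF \<open>open U\<close>, of UNIV, OF Ck_on_mult[OF \<open>open U\<close>
            _ Suc.IH]]])
      (use d c Suc.prems in \<open>auto simp: frechet_derivative_chain_real\<close>)
  moreover have "(\<lambda>x. f (\<phi> x)) differentiable_on U"
    using d differentiable_chain_at[of \<phi> _ f]
    by (auto simp: comp_def intro!: differentiable_at_imp_differentiable_on)
  ultimately show ?case by auto
qed

section \<open>Bump functions\<close>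

text \<open>The classical smooth function \<open>exp (- (1 / t))\<close>, extended by zero to
  \<open>t \<le> 0\<close>. The additional power of \<open>1 / t\<close> makes the family closed
  under differentiation up to linear combinations.\<close>

definition flat_exp :: "nat \<Rightarrow> real \<Rightarrow> real" where
  "flat_exp n t = (if t > 0 then (1 / t) ^ n * exp (- (1 / t)) else 0)"

text \<open>From the right, the substitution of \<open>inverse t\<close> for the variable reduces
  the limit to the decay of a power divided by the exponential at infinity; from the left the
  function is constantly zero.\<close>

lemma flat_exp_tendsto_0: "(flat_exp n \<longlongrightarrow> 0) (at 0)"
  unfolding filterlim_at_split
proof
  have "eventually (\<lambda>t. t < (0::real)) (at_left 0)"
    by (simp add: eventually_at_filter)
  then have "eventually (\<lambda>t. flat_exp n t = 0) (at_left 0)"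
    by eventually_elim (simp add: flat_exp_def)
  then show "(flat_exp n \<longlongrightarrow> 0) (at_left 0)"
    by (rule tendsto_eventually)
next
  have "((\<lambda>t::real. inverse t ^ n / exp (inverse t)) \<longlongrightarrow> 0) (at_right 0)"
    by (rule filterlim_compose[OF tendsto_power_div_exp_0 filterlim_inverse_at_top_right])
  moreover have "eventually (\<lambda>t. t > (0::real)) (at_right 0)"
    by (simp add: eventually_at_filter)
  then have "eventually (\<lambda>t::real. inverse t ^ n / exp (inverse t) = flat_exp n t) (at_right 0)"
    by eventually_elim (simp add: flat_exp_def exp_minus divide_inverse)
  ultimately show "(flat_exp n \<longlongrightarrow> 0) (at_right 0)"
    by (rule Lim_transform_eventually)
qed

lemma has_real_derivative_flat_exp:
  "(flat_exp n has_real_derivative flat_exp (n + 2) t - real n * flat_exp (n + 1) t) (at t)"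
proof -
  consider "t > 0" | "t < 0" | "t = 0" by linarith
  then show ?thesis
  proof cases
    case 1
    have D: "((\<lambda>t. 1 / t) has_real_derivative - ((1 / t) * (1 / t))) (at t)"
      using 1 by (auto intro!: derivative_eq_intros)
    have "((\<lambda>t. (1 / t) ^ n * exp (- (1 / t))) has_real_derivative
        flat_exp (n + 2) t - real n * flat_exp (n + 1) t) (at t)"
      by (rule DERIV_cong[OF DERIV_mult[OF DERIV_power[OF D] DERIV_fun_exp[OF DERIV_minus[OF D]]]])
        (use 1 in \<open>cases n; simp add: flat_exp_def algebra_simps\<close>)
    then show ?thesis
      by (rule has_field_derivative_transform_within_open[where S = "{0<..}"]) (use 1 in \<open>auto simp: flat_exp_def\<close>)
  next
    case 2
    have "((\<lambda>t. 0) has_real_derivative flat_exp (n + 2) t - real n * flat_exp (n + 1) t) (at t)"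
      using 2 by (simp add: flat_exp_def)
    then show ?thesis
      by (rule has_field_derivative_transform_within_open[where S = "{..<0}"]) (use 2 in \<open>auto simp: flat_exp_def\<close>)
  next
    case 3
    \<comment> \<open>At the origin the difference quotient is itself a member of the family,
      because dividing by \<open>h\<close> raises the power by one. Its limit is therefore already
      known to be zero.\<close>
    have "(\<lambda>h. (flat_exp n (0 + h) - flat_exp n 0) / h) = flat_exp (n + 1)"
      by (auto simp: flat_exp_def)
    then show ?thesis
      using flat_exp_tendsto_0[of "n + 1"] 3 by (simp add: DERIV_def flat_exp_def)
  qed
qed

text \<open>Differentiating once replaces index \<open>n\<close> by \<open>n + 1\<close> and
  \<open>n + 2\<close> and produces a factor from the derivative of \<open>s\<close>. Induction on
  the order with \<open>n\<close> arbitrary then covers all derivatives.\<close>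

lemma Ck_on_flat_exp_compose:
  assumes "open U" "\<And>k. Ck_on k U s"
  shows "Ck_on k U (\<lambda>x. flat_exp n (s x))"
proof (induction k arbitrary: n)
  case 0
  have "continuous_on UNIV (flat_exp n)"
    using has_real_derivative_flat_exp DERIV_isCont continuous_at_imp_continuous_on by blast
  then show ?case
    using assms(2)[of 0] continuous_on_compose2[of UNIV "flat_exp n" U s] by auto
next
  case (Suc k)
  have D: "((\<lambda>x. flat_exp n (s x)) has_derivative
      (\<lambda>h. (flat_exp (n + 2) (s x) - real n * flat_exp (n + 1) (s x)) * frechet_derivative s (at x) h)) (at x)"
    if "x \<in> U" for x
  proof -
    have "s differentiable at x"
      using assms(1) assms(2)[of 1] that by (auto simp: differentiable_on_eq_differentiable_at)
    then have "(s has_derivative frechet_derivative s (at x)) (at x)"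
      by (simp add: frechet_derivative_works)
    from has_derivative_compose[OF this has_real_derivative_flat_exp[unfolded has_field_derivative_def]]
    show ?thesis .
  qed
  have s': "Ck_on k U (\<lambda>x. frechet_derivative s (at x) (axis i 1))" for i
    using assms(2)[of "Suc k"] by simp
  have "Ck_on k U (\<lambda>x. frechet_derivative (\<lambda>x. flat_exp n (s x)) (at x) (axis i 1))" for i
  proof (rule Ck_on_cong[OF \<open>open U\<close>])
    show "Ck_on k U (\<lambda>x. (flat_exp (n + 2) (s x) + (- real n) * flat_exp (n + 1) (s x))
        * frechet_derivative s (at x) (axis i 1))"
      by (intro Ck_on_mult Ck_on_add Ck_on_const assms(1) s' Suc.IH)
    show "(flat_exp (n + 2) (s x) + (- real n) * flat_exp (n + 1) (s x))
        * frechet_derivative s (at x) (axis i 1)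
        = frechet_derivative (\<lambda>x. flat_exp n (s x)) (at x) (axis i 1)" if "x \<in> U" for x
      using fun_cong[OF frechet_derivative_at[OF D[OF that]], of "axis i 1"] by simp
  qed
  moreover have "(\<lambda>x. flat_exp n (s x)) differentiable_on U"
    using D by (blast intro: differentiable_at_imp_differentiable_on differentiableI)
  ultimately show ?case by simp
qed

lemma Ck_on_vec_nth: "Ck_on k U (\<lambda>x::real^'n. x $ i)"
proof -
  have D: "((\<lambda>x::real^'n. x $ i) has_derivative (\<lambda>h. h $ i)) (at x)" for x
    by (rule bounded_linear.has_derivative[OF bounded_linear_vec_nth has_derivative_ident])
  have "frechet_derivative (\<lambda>x::real^'n. x $ i) (at x) = (\<lambda>h. h $ i)" for x
    using frechet_derivative_at[OF D] by simp
  moreover have "(\<lambda>x::real^'n. x $ i) differentiable_on U"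
    using D by (blast intro: differentiable_at_imp_differentiable_on differentiableI)
  ultimately show ?thesis
    by (cases k) (auto intro: Ck_on_const continuous_intros)
qed

lemma smooth_bump_exists:
  fixes a :: "real^'n"
  assumes "r > 0"
  obtains f where "\<And>U. open U \<Longrightarrow> smooth_on U f" "f a = 1" "\<And>x. x \<notin> cball a r \<Longrightarrow> f x = 0"
proof
  \<comment> \<open>This is the squared radius minus the squared distance to \<open>a\<close>,
    positive exactly inside the ball. It is spelled out with sums and products of coordinates and
    constants so that the closure rules for \<open>Ck_on\<close> match it.\<close>
  define s where "s x = r\<^sup>2 + (\<Sum>i\<in>UNIV. (- 1) * ((x $ i + - a $ i) * (x $ i + - a $ i)))" for x
  have s: "s x = r\<^sup>2 - (norm (x - a))\<^sup>2" for x
    unfolding s_def power2_norm_eq_inner by (simp add: inner_vec_def sum_negf)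
  \<comment> \<open>The constant factor normalises the value at the centre, where \<open>s a\<close>
    is \<open>r\<^sup>2\<close>, to 1.\<close>
  let ?f = "\<lambda>x. exp (1 / r\<^sup>2) * flat_exp 0 (s x)"
  show "smooth_on U ?f" if "open U" for U
    unfolding smooth_on_def s_def
    by (intro allI Ck_on_mult Ck_on_const that Ck_on_flat_exp_compose Ck_on_add Ck_on_sum Ck_on_vec_nth)
  show "?f a = 1"
    using assms by (simp add: s flat_exp_def exp_minus)
  show "?f x = 0" if "x \<notin> cball a r" for x
  proof -
    have "r\<^sup>2 < (norm (x - a))\<^sup>2"
      using that assms by (intro power_strict_mono) (auto simp: dist_norm norm_minus_commute)
    then show ?thesis by (simp add: s flat_exp_def)
  qed
qed

section \<open>Extension of tangent vectors to vector fields\<close>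

lemma cinv_cmap:
  assumes "chart_on M c" "q \<in> cdom c"
  shows "cinv c (cmap c q) = q"
proof -
  have "inj_on (cmap c) (topspace (subtopology M (cdom c)))"
    using assms(1) homeomorphic_imp_injective_map unfolding chart_on_def by blast
  moreover have "topspace (subtopology M (cdom c)) = cdom c"
    using assms(1) openin_subset unfolding chart_on_def topspace_subtopology by blast
  ultimately show ?thesis
    using assms(2) by (simp add: cinv_def)
qed

lemma open_cmap_image:
  assumes "chart_on M c" "openin M W" "W \<subseteq> cdom c"
  shows "open (cmap c ` W)"
proof -
  have "openin (subtopology M (cdom c)) W"
    using assms by (auto simp: openin_subtopology)
  moreover have "open_map (subtopology M (cdom c)) (top_of_set (cmap c ` cdom c)) (cmap c)"
    using assms(1) homeomorphic_imp_open_map unfolding chart_on_def by blast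
  ultimately have "openin (top_of_set (cmap c ` cdom c)) (cmap c ` W)"
    unfolding open_map_def by blast
  then show ?thesis
    using assms(1) openin_open_trans unfolding chart_on_def by blast
qed

text \<open>On the image of the chart the inverse homeomorphism coincides with
  \<open>cinv c\<close>, and continuous images of compact sets are compact. This provides the
  compact support of the cut-off field.\<close>

lemma compactin_cinv_image:
  assumes "chart_on M c" "compact K" "K \<subseteq> cmap c ` cdom c"
  shows "compactin M (cinv c ` K)"
proof -
  obtain h where h: "homeomorphic_maps (subtopology M (cdom c)) (top_of_set (cmap c ` cdom c)) (cmap c) h"
    using assms(1) unfolding chart_on_def homeomorphic_map_maps by blast
  have sub: "cdom c \<subseteq> topspace M"
    using assms(1) openin_subset unfolding chart_on_def by blast
  have "compactin (top_of_set (cmap c ` cdom c)) K"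
    using assms(2,3) by (simp add: compactin_subtopology)
  moreover have "continuous_map (top_of_set (cmap c ` cdom c)) (subtopology M (cdom c)) h"
    using h by (simp add: homeomorphic_maps_def)
  ultimately have "compactin (subtopology M (cdom c)) (h ` K)"
    using image_compactin by blast
  moreover have "h ` K = cinv c ` K"
  proof (rule image_cong)
    fix x assume "x \<in> K"
    then obtain q where q: "q \<in> cdom c" "x = cmap c q"
      using assms(3) by blast
    then have "h x = q"
      using h sub by (auto simp: homeomorphic_maps_def)
    then show "h x = cinv c x"
      using q cinv_cmap[OF assms(1)] by simp
  qed simp
  ultimately show ?thesis by (simp add: compactin_subtopology)
qed

section \<open>Transition maps and their Jacobians\<close>

context
  fixes M :: "'a topology" and \<A> :: "('a, 'n::finite) chart set"
  assumes mfd: "smooth_manifold M \<A>"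
begin

lemma chart_onI: "c \<in> \<A> \<Longrightarrow> chart_on M c"
  using mfd by (simp add: smooth_manifold_def)

lemma openin_cdom: "c \<in> \<A> \<Longrightarrow> openin M (cdom c)"
  using chart_onI by (auto simp: chart_on_def)

lemma transition_cmap: "c \<in> \<A> \<Longrightarrow> q \<in> cdom c \<Longrightarrow> transition c d (cmap c q) = cmap d q"
  by (simp add: transition_def cinv_cmap[OF chart_onI])

lemma open_overlap: "c \<in> \<A> \<Longrightarrow> d \<in> \<A> \<Longrightarrow> open (cmap c ` (cdom c \<inter> cdom d))"
  by (rule open_cmap_image[OF chart_onI]) (auto intro: openin_Int openin_cdom)

lemma Ck_on_transition:
  "c \<in> \<A> \<Longrightarrow> d \<in> \<A> \<Longrightarrow> Ck_on k (cmap c ` (cdom c \<inter> cdom d)) (\<lambda>x. transition c d x $ i)"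
  using mfd by (simp add: smooth_manifold_def smooth_on_def)

lemma transition_differentiable:
  assumes "c \<in> \<A>" "d \<in> \<A>" "q \<in> cdom c \<inter> cdom d"
  shows "transition c d differentiable at (cmap c q)"
proof -
  have "(\<lambda>x. transition c d x $ i) differentiable_on cmap c ` (cdom c \<inter> cdom d)" for i
    using Ck_on_transition[OF assms(1,2), of 1] by simp
  then show ?thesis
    using assms open_overlap[OF assms(1,2)]
    by (simp add: differentiable_vec_iff differentiable_on_eq_differentiable_at)
qed

text \<open>\<open>transition c c\<close> is known to be the identity only on the image of the
  chart, but that image is open, so the derivative there is the identity.\<close>

lemma transition_jacobian_self:
  assumes "c \<in> \<A>" "q \<in> cdom c"
  shows "transition_jacobian c c q = mat 1"
proof -
  have "frechet_derivative id (at (cmap c q)) = frechet_derivative (transition c c) (at (cmap c q))"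
    by (rule frechet_derivative_transform_within_open[where X = "cmap c ` (cdom c \<inter> cdom c)"])
      (use assms open_overlap[OF assms(1,1)] in \<open>auto simp: transition_cmap id_def\<close>)
  then have "frechet_derivative (transition c c) (at (cmap c q)) = id"
    by (metis frechet_derivative_id)
  then show ?thesis
    by (simp add: transition_jacobian_def jacobian_def matrix_id_mat_1)
qed

text \<open>The chain rule applies because the transition from \<open>c\<close> to \<open>e\<close>
  factors through \<open>d\<close> on the image of the triple overlap, an open neighbourhood of the
  point. It makes the transformation law consistent across charts.\<close>

lemma transition_jacobian_cocycle:
  assumes "c \<in> \<A>" "d \<in> \<A>" "e \<in> \<A>" "q \<in> cdom c" "q \<in> cdom d" "q \<in> cdom e"
  shows "transition_jacobian c e q = transition_jacobian d e q ** transition_jacobian c d q"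
proof -
  let ?W = "cmap c ` (cdom c \<inter> cdom d \<inter> cdom e)"
  have de: "transition d e differentiable at (transition c d (cmap c q))"
    using transition_differentiable[OF assms(2,3)] assms by (simp add: transition_cmap)
  have cd: "transition c d differentiable at (cmap c q)"
    using transition_differentiable[OF assms(1,2)] assms by simp
  have "open ?W"
    by (rule open_cmap_image[OF chart_onI]) (use assms in \<open>auto intro: openin_Int openin_cdom\<close>)
  then have "frechet_derivative (transition d e \<circ> transition c d) (at (cmap c q))
      = frechet_derivative (transition c e) (at (cmap c q))"
    by (intro frechet_derivative_transform_within_open[where X = ?W] differentiable_chain_at cd de)
      (use assms in \<open>auto simp: transition_cmap\<close>)
  then have "frechet_derivative (transition c e) (at (cmap c q))
      = frechet_derivative (transition d e) (at (cmap d q)) \<circ> frechet_derivative (transition c d) (at (cmap c q))"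
    using frechet_derivative_compose[OF cd de] assms by (simp add: transition_cmap)
  then show ?thesis
    using matrix_compose[OF linear_frechet_derivative[OF cd] linear_frechet_derivative[OF de]] assms
    by (simp add: transition_jacobian_def jacobian_def transition_cmap)
qed

text \<open>The Jacobian entries are partial derivatives in the coordinates of \<open>c\<close>.
  Composition with the transition from \<open>d\<close> to \<open>c\<close> rewrites them in the
  coordinates of \<open>d\<close>, where the smoothness of components in \<open>d\<close> is
  tested.\<close>

lemma Ck_on_transition_jacobian:
  assumes "c \<in> \<A>" "d \<in> \<A>"
  shows "Ck_on k (cmap d ` (cdom c \<inter> cdom d)) (\<lambda>x. transition_jacobian c d (cinv d x) $ i $ j)"
proof -
  let ?U = "cmap d ` (cdom d \<inter> cdom c)" and ?V = "cmap c ` (cdom c \<inter> cdom d)"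
  let ?D = "\<lambda>y. frechet_derivative (\<lambda>y. transition c d y $ i) (at y) (axis j 1)"
  have "Ck_on k ?V ?D"
    using Ck_on_transition[OF assms, of "Suc k" i] by simp
  then have "Ck_on k ?U (\<lambda>x. ?D (transition d c x))"
    by (rule Ck_on_compose[where V = ?V and \<phi> = "transition d c", rotated -1])
      (use assms open_overlap Ck_on_transition in \<open>auto simp: transition_cmap\<close>)
  moreover have "?D (transition d c x) = transition_jacobian c d (cinv d x) $ i $ j" if "x \<in> ?U" for x
  proof -
    obtain q where q: "q \<in> cdom c \<inter> cdom d" "x = cmap d q"
      using \<open>x \<in> ?U\<close> by blast
    then show ?thesis
      using assms frechet_derivative_vec_nth[OF transition_differentiable[OF assms q(1)]]
      by (simp add: transition_cmap cinv_cmap[OF chart_onI] transition_jacobian_def jacobian_def matrix_def)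
  qed
  ultimately have "Ck_on k ?U (\<lambda>x. transition_jacobian c d (cinv d x) $ i $ j)"
    by (rule Ck_on_cong[OF open_overlap[OF assms(2,1)], rotated])
  then show ?thesis by (simp add: Int_commute)
qed

text \<open>The vector is spread out with constant components in \<open>c\<close>, cut off by a bump function. The
  support of the bump is compact, hence closed because \<open>M\<close> is Hausdorff; so the extension by zero
  is smooth.\<close>

lemma vector_field_extension:
  fixes v :: "real^'n"
  assumes "c \<in> \<A>" "p \<in> cdom c"
  obtains X where "vector_field \<A> X" "X c p = v"
proof -
  have "open (cmap c ` cdom c)"
    using chart_onI[OF assms(1)] by (simp add: chart_on_def)
  then obtain r where r: "r > 0" "cball (cmap c p) r \<subseteq> cmap c ` cdom c"
    using assms(2) open_contains_cball_eq by blast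
  obtain f where f: "\<And>U. open U \<Longrightarrow> smooth_on U f" "f (cmap c p) = 1"
      "\<And>x. x \<notin> cball (cmap c p) r \<Longrightarrow> f x = 0"
    using smooth_bump_exists[OF r(1)] by blast
  define K where "K = cinv c ` cball (cmap c p) r"
  have "closedin M K"
    using compactin_cinv_image[OF chart_onI[OF assms(1)] compact_cball r(2)] mfd compactin_imp_closedin
    unfolding K_def smooth_manifold_def by blast
  have K: "K \<subseteq> cdom c" "\<And>q. q \<in> cdom c \<Longrightarrow> q \<notin> K \<Longrightarrow> f (cmap c q) = 0"
  proof -
    show "K \<subseteq> cdom c"
    proof
      fix q assume "q \<in> K"
      then obtain q' where "q' \<in> cdom c" "q = cinv c (cmap c q')"
        using r(2) unfolding K_def by blast
      then show "q \<in> cdom c" using cinv_cmap[OF chart_onI[OF assms(1)]] by simp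
    qed
    show "f (cmap c q) = 0" if "q \<in> cdom c" "q \<notin> K" for q
      using that f(3) cinv_cmap[OF chart_onI[OF assms(1)]] unfolding K_def by (metis imageI)
  qed
  define X where "X d q = (if q \<in> cdom c \<and> q \<in> cdom d
      then f (cmap c q) *\<^sub>R (transition_jacobian c d q *v v) else 0)" for d q
  have X0: "X d q = 0" if "q \<notin> K" for d q
    using K that by (simp add: X_def)
  have "smooth_in_chart d (\<lambda>q. X d q $ i)" if d: "d \<in> \<A>" for d i
    unfolding smooth_in_chart_def smooth_on_def
  proof (intro allI Ck_on_local)
    fix k x assume "x \<in> cmap d ` cdom d"
    then obtain q where q: "q \<in> cdom d" "x = cmap d q" by blast
    note inv = cinv_cmap[OF chart_onI[OF d]]
    \<comment> \<open>As \<open>K\<close> lies in \<open>cdom c\<close>, the domain of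
      \<open>d\<close> is covered by two open sets: its overlap with \<open>cdom c\<close>, where
      the explicit formula holds, and the complement of \<open>K\<close>, where the field
      vanishes.\<close>
    show "\<exists>V. open V \<and> x \<in> V \<and> Ck_on k V ((\<lambda>q. X d q $ i) \<circ> cinv d)"
    proof (cases "q \<in> cdom c")
      case True
      let ?V = "cmap d ` (cdom d \<inter> cdom c)"
      have V: "open ?V" using open_overlap d assms by blast
      have "Ck_on k ?V (\<lambda>x. f (transition d c x))"
        by (rule Ck_on_compose[where V = UNIV and \<phi> = "transition d c"])
          (use V f(1) d assms Ck_on_transition in \<open>auto simp: smooth_on_def\<close>)
      moreover have "Ck_on k ?V (\<lambda>x. transition_jacobian c d (cinv d x) $ i $ j)" for j
        using Ck_on_transition_jacobian[OF assms(1) d] by (simp add: Int_commute)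
      ultimately have "Ck_on k ?V (\<lambda>x. f (transition d c x) *
          (\<Sum>j\<in>UNIV. transition_jacobian c d (cinv d x) $ i $ j * v $ j))"
        by (intro Ck_on_mult Ck_on_sum V Ck_on_const)
      then have "Ck_on k ?V ((\<lambda>q. X d q $ i) \<circ> cinv d)"
        by (rule Ck_on_cong[OF V, rotated])
          (auto simp: X_def inv transition_cmap[OF d] matrix_vector_mult_def)
      then show ?thesis using V q True by blast
    next
      case False
      let ?V = "cmap d ` (cdom d - K)"
      have "open ?V"
        by (rule open_cmap_image[OF chart_onI[OF d]])
          (use openin_diff[OF openin_cdom[OF d] \<open>closedin M K\<close>] in auto)
      moreover have "Ck_on k ?V ((\<lambda>q. X d q $ i) \<circ> cinv d)"
        by (rule Ck_on_cong[OF \<open>open ?V\<close> _ Ck_on_const[where a = 0]]) (auto simp: inv X0)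
      ultimately show ?thesis using q False K(1) by blast
    qed
  qed
  \<comment> \<open>Inside \<open>cdom c\<close> this is the cocycle identity applied to the scaled
    vector; outside it both sides are zero.\<close>
  moreover have "X e q = transition_jacobian d e q *v X d q"
    if "d \<in> \<A>" "e \<in> \<A>" "q \<in> cdom d \<inter> cdom e" for d e q
    using that transition_jacobian_cocycle[OF assms(1) that(1,2), of q]
    by (simp add: X_def matrix_vector_mult_scaleR matrix_vector_mul_assoc)
  ultimately have "vector_field \<A> X"
    unfolding vector_field_def by blast
  moreover have "X c p = v"
    using assms f(2) by (simp add: X_def transition_jacobian_self)
  ultimately show ?thesis using that by blast
qed

end

section \<open>Second derivatives and inverse matrices\<close>

lemma has_real_derivative_along_line:
  fixes f :: "real^'n \<Rightarrow> real"
  assumes "f differentiable at (w + s *\<^sub>R u)"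
  shows "((\<lambda>s. f (w + s *\<^sub>R u)) has_real_derivative frechet_derivative f (at (w + s *\<^sub>R u)) u) (at s)"
proof -
  have "(f has_derivative frechet_derivative f (at (w + s *\<^sub>R u))) (at (w + s *\<^sub>R u))"
    using assms by (simp add: frechet_derivative_works)
  moreover have "((\<lambda>s. w + s *\<^sub>R u) has_derivative (\<lambda>h. h *\<^sub>R u)) (at s)"
    by (auto intro!: derivative_eq_intros)
  ultimately have "((\<lambda>s. f (w + s *\<^sub>R u)) has_derivative
      (\<lambda>h. frechet_derivative f (at (w + s *\<^sub>R u)) (h *\<^sub>R u))) (at s)"
    using has_derivative_compose by blast
  then show ?thesis
    by (simp add: has_field_derivative_def linear_cmul[OF linear_frechet_derivative[OF assms]]
        mult_commute_abs)
qed

text \<open>The mean value theorem is applied twice: in direction \<open>i\<close> to the difference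
  of \<open>f\<close> along two parallel edges of a small square, then in direction \<open>j\<close>
  to the resulting partial derivative. The bound on \<open>2 * \<delta>\<close> keeps the square
  inside the ball.\<close>

lemma second_difference_eq:
  fixes f :: "real^'n \<Rightarrow> real"
  assumes ball: "ball x r \<subseteq> U" and \<delta>: "\<delta> > 0" "2 * \<delta> < r"
    and f: "\<And>y. y \<in> U \<Longrightarrow> f differentiable at y"
    and f': "\<And>y. y \<in> U \<Longrightarrow> (\<lambda>y. frechet_derivative f (at y) (axis i 1)) differentiable at y"
  shows "\<exists>y\<in>ball x r. f (x + \<delta> *\<^sub>R axis i 1 + \<delta> *\<^sub>R axis j 1) - f (x + \<delta> *\<^sub>R axis i 1)
      - f (x + \<delta> *\<^sub>R axis j 1) + f x
    = \<delta>\<^sup>2 * frechet_derivative (\<lambda>y. frechet_derivative f (at y) (axis i 1)) (at y) (axis j 1)"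
proof -
  let ?i = "axis i 1 :: real^'n" and ?j = "axis j 1 :: real^'n"
  let ?f' = "\<lambda>y. frechet_derivative f (at y) ?i"
  have mem: "x + s *\<^sub>R ?i + t *\<^sub>R ?j \<in> ball x r" if "0 \<le> s" "s \<le> \<delta>" "0 \<le> t" "t \<le> \<delta>" for s t
  proof -
    have "norm (t *\<^sub>R ?j + s *\<^sub>R ?i) \<le> s + t"
      using norm_triangle_ineq[of "t *\<^sub>R ?j" "s *\<^sub>R ?i"] that by (simp add: norm_axis_1)
    then show ?thesis
      using that \<delta> by (simp add: dist_norm norm_minus_commute add.assoc)
  qed
  let ?\<phi> = "\<lambda>s. f (x + \<delta> *\<^sub>R ?j + s *\<^sub>R ?i) - f (x + s *\<^sub>R ?i)"
  have "(?\<phi> has_real_derivative ?f' (x + \<delta> *\<^sub>R ?j + s *\<^sub>R ?i) - ?f' (x + s *\<^sub>R ?i)) (at s)"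
    if "0 \<le> s" "s \<le> \<delta>" for s
    using mem[OF that, of \<delta>] mem[OF that, of 0] \<delta> ball
    by (intro DERIV_diff has_real_derivative_along_line f) (auto simp: algebra_simps)
  from MVT2[OF \<delta>(1) this] obtain s where s: "0 < s" "s < \<delta>"
      "?\<phi> \<delta> - ?\<phi> 0 = \<delta> * (?f' (x + \<delta> *\<^sub>R ?j + s *\<^sub>R ?i) - ?f' (x + s *\<^sub>R ?i))"
    by auto
  have "((\<lambda>t. ?f' (x + s *\<^sub>R ?i + t *\<^sub>R ?j)) has_real_derivative
      frechet_derivative ?f' (at (x + s *\<^sub>R ?i + t *\<^sub>R ?j)) ?j) (at t)" if "0 \<le> t" "t \<le> \<delta>" for t
    using mem[of s t] that s ball by (intro has_real_derivative_along_line f') auto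
  from MVT2[OF \<delta>(1) this] obtain t where t: "0 < t" "t < \<delta>"
      "?f' (x + s *\<^sub>R ?i + \<delta> *\<^sub>R ?j) - ?f' (x + s *\<^sub>R ?i + 0 *\<^sub>R ?j)
       = \<delta> * frechet_derivative ?f' (at (x + s *\<^sub>R ?i + t *\<^sub>R ?j)) ?j"
    by auto
  have "x + s *\<^sub>R ?i + t *\<^sub>R ?j \<in> ball x r"
    using mem s t by simp
  then show ?thesis
    using s(3) t(3) by (intro bexI[of _ "x + s *\<^sub>R ?i + t *\<^sub>R ?j"])
      (simp_all add: add.commute add.left_commute power2_eq_square algebra_simps)
qed

text \<open>The second difference is symmetric in \<open>i\<close> and \<open>j\<close>, so it
  expresses both mixed partials, each at some point close to \<open>x\<close>. Since both are
  continuous at \<open>x\<close>, different values there would be contradictory.\<close>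

lemma mixed_partials_commute:
  fixes f :: "real^'n \<Rightarrow> real"
  assumes "open U" "Ck_on 2 U f" "x \<in> U"
  shows "frechet_derivative (\<lambda>y. frechet_derivative f (at y) (axis i 1)) (at x) (axis j 1)
       = frechet_derivative (\<lambda>y. frechet_derivative f (at y) (axis j 1)) (at x) (axis i 1)"
    (is "?a x = ?b x")
proof (rule ccontr)
  assume "?a x \<noteq> ?b x"
  \<comment> \<open>With half the gap as tolerance, a value of \<open>?a\<close> near
    \<open>x\<close> cannot equal a value of \<open>?b\<close> near \<open>x\<close>.\<close>
  define e where "e = \<bar>?a x - ?b x\<bar> / 2"
  have "e > 0" using \<open>?a x \<noteq> ?b x\<close> by (simp add: e_def)
  have C: "Ck_on (Suc (Suc 0)) U f" using assms(2) by (simp add: numeral_2_eq_2)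
  have f: "f differentiable at y" if "y \<in> U" for y
    using C that assms(1) by (auto simp: differentiable_on_eq_differentiable_at)
  have f': "(\<lambda>y. frechet_derivative f (at y) (axis k 1)) differentiable at y" if "y \<in> U" for y k
    using C that assms(1) by (auto simp: differentiable_on_eq_differentiable_at)
  have near: "\<forall>\<^sub>F y in nhds x. dist (g y) (g x) < e" if "isCont g x" for g :: "real^'n \<Rightarrow> real"
    using tendstoD[OF iffD1[OF tendsto_at_iff_tendsto_nhds that[unfolded isCont_def]] \<open>e > 0\<close>] .
  have "isCont ?a x" "isCont ?b x"
    using C assms(1,3) by (auto simp: continuous_on_eq_continuous_at)
  note this[THEN near]
  moreover have "\<forall>\<^sub>F y in nhds x. y \<in> U"
    using assms by (simp add: eventually_nhds_in_open)
  ultimately have "\<forall>\<^sub>F y in nhds x. dist (?a y) (?a x) < e \<and> dist (?b y) (?b x) < e \<and> y \<in> U"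
    by eventually_elim simp
  then obtain r where r: "r > 0"
      "\<And>y. dist y x < r \<Longrightarrow> dist (?a y) (?a x) < e \<and> dist (?b y) (?b x) < e \<and> y \<in> U"
    unfolding eventually_nhds_metric by blast
  have ball: "ball x r \<subseteq> U" using r(2) by (auto simp: dist_commute)
  define \<delta> where "\<delta> = r / 3"
  have \<delta>: "\<delta> > 0" "2 * \<delta> < r" using r(1) by (auto simp: \<delta>_def)
  obtain y where y: "y \<in> ball x r" "f (x + \<delta> *\<^sub>R axis i 1 + \<delta> *\<^sub>R axis j 1) - f (x + \<delta> *\<^sub>R axis i 1)
      - f (x + \<delta> *\<^sub>R axis j 1) + f x = \<delta>\<^sup>2 * ?a y"
    using second_difference_eq[where i = i and j = j, OF ball \<delta> f f'] by blast
  obtain z where z: "z \<in> ball x r" "f (x + \<delta> *\<^sub>R axis j 1 + \<delta> *\<^sub>R axis i 1) - f (x + \<delta> *\<^sub>R axis j 1)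
      - f (x + \<delta> *\<^sub>R axis i 1) + f x = \<delta>\<^sup>2 * ?b z"
    using second_difference_eq[where i = j and j = i, OF ball \<delta> f f'] by blast
  have "f (x + \<delta> *\<^sub>R axis i 1 + \<delta> *\<^sub>R axis j 1) = f (x + \<delta> *\<^sub>R axis j 1 + \<delta> *\<^sub>R axis i 1)"
    by (simp add: algebra_simps)
  then have "\<delta>\<^sup>2 * ?a y = \<delta>\<^sup>2 * ?b z"
    using y(2) z(2) by linarith
  then have "?a y = ?b z" using \<delta>(1) by simp
  moreover have "\<bar>?a y - ?a x\<bar> < e" "\<bar>?b z - ?b x\<bar> < e"
    using r(2)[of y] r(2)[of z] y(1) z(1) by (auto simp: dist_commute dist_real_def)
  ultimately have "\<bar>?a x - ?b x\<bar> < 2 * e" by linarith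
  then show False by (simp add: e_def)
qed

section \<open>Differentiability of the inverse of a matrix\<close>

lemma differentiable_prod_real:
  fixes f :: "'i \<Rightarrow> 'b::real_normed_vector \<Rightarrow> real"
  assumes "\<And>i. i \<in> I \<Longrightarrow> f i differentiable at x"
  shows "(\<lambda>x. \<Prod>i\<in>I. f i x) differentiable at x"
  using assms by (induction I rule: infinite_finite_induct) (auto intro: differentiable_mult)

lemma differentiable_det:
  fixes A :: "'b::real_normed_vector \<Rightarrow> real^'m^'m"
  assumes "\<And>i j. (\<lambda>y. A y $ i $ j) differentiable at x"
  shows "(\<lambda>y. det (A y)) differentiable at x"
  unfolding det_def
  by (intro differentiable_sum ballI differentiable_mult differentiable_const differentiable_prod_real assms)
    (simp add: finite_permutations)

lemma matrix_inv:
  fixes A :: "real^'m^'m"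
  assumes "invertible A"
  shows matrix_inv_right: "A ** matrix_inv A = mat 1" and matrix_inv_left: "matrix_inv A ** A = mat 1"
  using someI_ex[OF assms[unfolded invertible_def]] unfolding matrix_inv_def by auto

text \<open>Cramer's rule for the equation whose right-hand side is the unit vector
  \<open>axis l 1\<close>. It exhibits every entry of the inverse as a quotient of polynomials in
  the entries of \<open>A\<close>.\<close>

lemma matrix_inv_nth:
  fixes A :: "real^'m^'m"
  assumes "invertible A"
  shows "matrix_inv A $ k $ l = det (\<chi> i j. if j = k then axis l 1 $ i else A $ i $ j) / det A"
proof -
  have "A *v (matrix_inv A *v axis l 1) = axis l 1"
    using matrix_inv_right[OF assms] by (simp add: matrix_vector_mul_assoc)
  moreover have "det A \<noteq> 0" using assms by (simp add: invertible_det_nz)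
  ultimately have "matrix_inv A *v axis l 1
      = (\<chi> k. det (\<chi> i j. if j = k then axis l 1 $ i else A $ i $ j) / det A)"
    using cramer by blast
  moreover have "matrix_inv A $ k $ l = (matrix_inv A *v axis l 1) $ k"
    by (simp add: matrix_vector_mult_basis column_def)
  ultimately show ?thesis by simp
qed

text \<open>The determinant quotient from Cramer's rule is differentiable at \<open>x\<close>. It
  agrees with the inverse only where \<open>A\<close> is invertible, so the derivative is
  transferred on the open set \<open>U\<close>.\<close>

lemma differentiable_matrix_inv:
  fixes A :: "'b::real_normed_vector \<Rightarrow> real^'m^'m"
  assumes "open U" "x \<in> U" "\<And>y. y \<in> U \<Longrightarrow> invertible (A y)"
    and A: "\<And>i j. (\<lambda>y. A y $ i $ j) differentiable at x"
  shows "(\<lambda>y. matrix_inv (A y) $ k $ l) differentiable at x"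
proof -
  let ?n = "\<lambda>y. det (\<chi> i j. if j = k then axis l 1 $ i else A y $ i $ j)"
  have "?n differentiable at x"
  proof (rule differentiable_det)
    show "(\<lambda>y. (\<chi> i j. if j = k then axis l 1 $ i else A y $ i $ j) $ i $ j) differentiable at x" for i j
      using A by (cases "j = k") auto
  qed
  moreover have "det (A x) \<noteq> 0"
    using assms(2,3) by (simp add: invertible_det_nz)
  ultimately have "(\<lambda>y. ?n y / det (A y)) differentiable at x"
    using differentiable_det[of A, OF A] by - (rule differentiable_divide; assumption)
  then obtain D where "((\<lambda>y. ?n y / det (A y)) has_derivative D) (at x)"
    by (auto simp: differentiable_def)
  then have "((\<lambda>y. matrix_inv (A y) $ k $ l) has_derivative D) (at x)"
    by (rule has_derivative_transform_within_open[OF _ assms(1,2)]) (simp add: matrix_inv_nth assms(3))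
  then show ?thesis by (rule differentiableI)
qed

section \<open>The metric as a bilinear form\<close>

lemma metric_eq_inner: "metric G p u v = u \<bullet> (G p *v v)"
  by (simp add: metric_def inner_vec_def matrix_vector_mult_def sum_distrib_left mult_ac)

lemma metric_commute:
  assumes "transpose (G p) = G p"
  shows "metric G p u v = metric G p v u"
proof -
  have "u \<bullet> (G p *v v) = (transpose (G p) *v u) \<bullet> v"
    unfolding transpose_matrix_vector dot_lmul_matrix ..
  then show ?thesis
    by (simp add: metric_eq_inner assms inner_commute)
qed

lemma metric_linear_simps:
  "metric G p (u + u') v = metric G p u v + metric G p u' v"
  "metric G p (u - u') v = metric G p u v - metric G p u' v"
  "metric G p (a *\<^sub>R u) v = a * metric G p u v"
  "metric G p u (v + v') = metric G p u v + metric G p u v'"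
  "metric G p u (v - v') = metric G p u v - metric G p u v'"
  "metric G p u (a *\<^sub>R v) = a * metric G p u v"
  by (simp_all add: metric_eq_inner inner_simps matrix_vector_mult_diff_distrib matrix_vector_right_distrib
     matrix_vector_mult_scaleR)

section \<open>The curvature tensor is skew in its last two arguments\<close>

lemma pderiv_chart_const [simp]: "pderiv_chart c i (\<lambda>q. a) p = 0"
  by (simp add: pderiv_chart_def comp_def)

text \<open>A first-order condition at a single point, suited to the Christoffel symbols, which the
  curvature differentiates only once.\<close>

definition differentiable_in_chart :: "('a, 'n::finite) chart \<Rightarrow> ('a \<Rightarrow> real) \<Rightarrow> 'a \<Rightarrow> bool" where
  "differentiable_in_chart c F p \<longleftrightarrow> (F \<circ> cinv c) differentiable at (cmap c p)"

lemma differentiable_in_chart_intros: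
  "differentiable_in_chart c (\<lambda>q. a) p"
  "differentiable_in_chart c F p \<Longrightarrow> differentiable_in_chart c H p \<Longrightarrow> differentiable_in_chart c (\<lambda>q. F q + H q) p"
  "differentiable_in_chart c F p \<Longrightarrow> differentiable_in_chart c H p \<Longrightarrow> differentiable_in_chart c (\<lambda>q. F q - H q) p"
  "differentiable_in_chart c F p \<Longrightarrow> differentiable_in_chart c H p \<Longrightarrow> differentiable_in_chart c (\<lambda>q. F q * H q) p"
  by (auto simp: differentiable_in_chart_def comp_def)

lemma differentiable_in_chart_sum:
  "(\<And>i. i \<in> I \<Longrightarrow> differentiable_in_chart c (F i) p) \<Longrightarrow> differentiable_in_chart c (\<lambda>q. \<Sum>i\<in>I. F i q) p"
  by (induction I rule: infinite_finite_induct) (auto intro: differentiable_in_chart_intros)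

lemma pderiv_chart_add:
  "differentiable_in_chart c F p \<Longrightarrow> differentiable_in_chart c H p \<Longrightarrow>
    pderiv_chart c i (\<lambda>q. F q + H q) p = pderiv_chart c i F p + pderiv_chart c i H p"
  by (simp add: differentiable_in_chart_def pderiv_chart_def comp_def frechet_derivative_add_real)

lemma pderiv_chart_sum:
  "(\<And>j. j \<in> J \<Longrightarrow> differentiable_in_chart c (F j) p) \<Longrightarrow>
    pderiv_chart c i (\<lambda>q. \<Sum>j\<in>J. F j q) p = (\<Sum>j\<in>J. pderiv_chart c i (F j) p)"
  by (simp add: differentiable_in_chart_def pderiv_chart_def comp_def frechet_derivative_sum_real)

context
  fixes M :: "'a topology" and c :: "('a, 'n::finite) chart"
  assumes chart: "chart_on M c"
begin

lemma cinv_image: "x \<in> cmap c ` cdom c \<Longrightarrow> cinv c x \<in> cdom c \<and> cmap c (cinv c x) = x"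
  using cinv_cmap[OF chart] by auto

lemma open_chart_image: "open (cmap c ` cdom c)"
  using chart by (simp add: chart_on_def)

lemma pderiv_chart_mult:
  "p \<in> cdom c \<Longrightarrow> differentiable_in_chart c F p \<Longrightarrow> differentiable_in_chart c H p \<Longrightarrow>
    pderiv_chart c i (\<lambda>q. F q * H q) p = F p * pderiv_chart c i H p + pderiv_chart c i F p * H p"
  by (simp add: differentiable_in_chart_def pderiv_chart_def comp_def frechet_derivative_mult_real cinv_cmap[OF chart])

lemma pderiv_chart_cong:
  assumes "p \<in> cdom c" "\<And>q. q \<in> cdom c \<Longrightarrow> F q = H q" "differentiable_in_chart c F p"
  shows "pderiv_chart c i F p = pderiv_chart c i H p"
proof -
  have "frechet_derivative (F \<circ> cinv c) (at (cmap c p)) = frechet_derivative (H \<circ> cinv c) (at (cmap c p))"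
    by (rule frechet_derivative_transform_within_open[OF _ open_chart_image])
      (use assms cinv_image in \<open>auto simp: differentiable_in_chart_def\<close>)
  then show ?thesis by (simp add: pderiv_chart_def)
qed

lemma differentiable_in_chart_smooth:
  assumes "smooth_in_chart c F" "p \<in> cdom c"
  shows "differentiable_in_chart c F p"
proof -
  have "Ck_on 1 (cmap c ` cdom c) (F \<circ> cinv c)"
    using assms(1) by (simp only: smooth_in_chart_def smooth_on_def)
  then show ?thesis
    using assms(2) open_chart_image
    by (auto simp: differentiable_in_chart_def differentiable_on_eq_differentiable_at)
qed

lemma differentiable_in_chart_pderiv_chart:
  assumes "smooth_in_chart c F" "p \<in> cdom c"
  shows "differentiable_in_chart c (pderiv_chart c i F) p"
proof -
  let ?D = "\<lambda>x. frechet_derivative (F \<circ> cinv c) (at x) (axis i 1)"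
  have "Ck_on (Suc 1) (cmap c ` cdom c) (F \<circ> cinv c)"
    using assms(1) by (simp only: smooth_in_chart_def smooth_on_def)
  then have "?D differentiable at (cmap c p)"
    using assms(2) open_chart_image by (auto simp: differentiable_on_eq_differentiable_at)
  then obtain D where "(?D has_derivative D) (at (cmap c p))"
    by (auto simp: differentiable_def)
  then have "((pderiv_chart c i F \<circ> cinv c) has_derivative D) (at (cmap c p))"
    by (rule has_derivative_transform_within_open[OF _ open_chart_image])
      (use assms(2) cinv_image in \<open>auto simp: pderiv_chart_def\<close>)
  then show ?thesis
    unfolding differentiable_in_chart_def by (rule differentiableI)
qed

text \<open>Passing through \<open>cinv c\<close> and back to coordinates is the identity only on
  the image of the chart; openness of that image makes the two derivatives agree. This brings
  iterated chart derivatives into the form needed for symmetry of second partials.\<close>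

lemma pderiv_chart_pderiv_chart:
  assumes "smooth_in_chart c F" "p \<in> cdom c"
  shows "pderiv_chart c j (pderiv_chart c i F) p
    = frechet_derivative (\<lambda>x. frechet_derivative (F \<circ> cinv c) (at x) (axis i 1)) (at (cmap c p)) (axis j 1)"
proof -
  have "frechet_derivative (pderiv_chart c i F \<circ> cinv c) (at (cmap c p))
      = frechet_derivative (\<lambda>x. frechet_derivative (F \<circ> cinv c) (at x) (axis i 1)) (at (cmap c p))"
    by (rule frechet_derivative_transform_within_open[OF _ open_chart_image])
      (use differentiable_in_chart_pderiv_chart[OF assms] assms(2) cinv_image
        in \<open>auto simp: pderiv_chart_def differentiable_in_chart_def\<close>)
  then show ?thesis by (simp add: pderiv_chart_def[of c j])
qed

lemma pderiv_chart_commute: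
  assumes "smooth_in_chart c F" "p \<in> cdom c"
  shows "pderiv_chart c j (pderiv_chart c i F) p = pderiv_chart c i (pderiv_chart c j F) p"
  unfolding pderiv_chart_pderiv_chart[OF assms]
  by (rule mixed_partials_commute[OF open_chart_image])
    (use assms in \<open>auto simp: smooth_in_chart_def smooth_on_def\<close>)

context

  \<comment> \<open>Christoffel symbols and metric compatibility\<close>
  fixes G :: "'a \<Rightarrow> real^'n^'n"
  assumes G_smooth: "\<And>i j. smooth_in_chart c (\<lambda>q. G q $ i $ j)"
    and G_symmetric: "\<And>q. q \<in> cdom c \<Longrightarrow> transpose (G q) = G q"
    and G_invertible: "\<And>q. q \<in> cdom c \<Longrightarrow> invertible (G q)"
begin

lemma G_nth_commute: "q \<in> cdom c \<Longrightarrow> G q $ i $ j = G q $ j $ i"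
  using G_symmetric by (metis transpose_def vec_lambda_beta)

lemma G_metric_commute: "q \<in> cdom c \<Longrightarrow> metric G q u v = metric G q v u"
  by (rule metric_commute) (rule G_symmetric)

lemma differentiable_in_chart_christoffel:
  assumes "p \<in> cdom c"
  shows "differentiable_in_chart c (christoffel c G k i j) p"
proof -
  have "differentiable_in_chart c (\<lambda>q. matrix_inv (G q) $ k $ l) p" for l
    unfolding differentiable_in_chart_def comp_def
  proof (rule differentiable_matrix_inv[OF open_chart_image])
    show "invertible (G (cinv c y))" if "y \<in> cmap c ` cdom c" for y
      using that cinv_image G_invertible by blast
    show "(\<lambda>y. G (cinv c y) $ i $ j) differentiable at (cmap c p)" for i j
      using differentiable_in_chart_smooth[OF G_smooth assms] by (simp add: differentiable_in_chart_def comp_def)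
  qed (use assms in auto)
  then show ?thesis
    unfolding christoffel_def
    by (intro differentiable_in_chart_intros differentiable_in_chart_sum
        differentiable_in_chart_pderiv_chart G_smooth assms)
qed

text \<open>Lowering the upper index cancels the inverse metric in the definition and leaves the
  Christoffel symbols of the first kind.\<close>

lemma christoffel_lower:
  assumes "p \<in> cdom c"
  shows "(\<Sum>a\<in>UNIV. G p $ a $ b * christoffel c G a i j p) = 1/2 *
     (pderiv_chart c i (\<lambda>q. G q $ j $ b) p + pderiv_chart c j (\<lambda>q. G q $ i $ b) p
      - pderiv_chart c b (\<lambda>q. G q $ i $ j) p)"
proof -
  let ?T = "\<lambda>l. pderiv_chart c i (\<lambda>q. G q $ j $ l) p + pderiv_chart c j (\<lambda>q. G q $ i $ l) p
      - pderiv_chart c l (\<lambda>q. G q $ i $ j) p"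
  have inv: "(\<Sum>a\<in>UNIV. G p $ a $ b * matrix_inv (G p) $ a $ l) = (if b = l then 1 else 0)" for l
  proof -
    have "(G p ** matrix_inv (G p)) $ b $ l = (if b = l then 1 else 0)"
      using matrix_inv_right[OF G_invertible[OF assms]] by (simp add: mat_def)
    then show ?thesis
      by (simp add: matrix_matrix_mult_def G_nth_commute[OF assms, of b])
  qed
  have "(\<Sum>a\<in>UNIV. G p $ a $ b * christoffel c G a i j p)
      = (\<Sum>a\<in>UNIV. \<Sum>l\<in>UNIV. 1/2 * ((G p $ a $ b * matrix_inv (G p) $ a $ l) * ?T l))"
    by (simp add: christoffel_def sum_distrib_left mult_ac)
  also have "\<dots> = 1/2 * (\<Sum>l\<in>UNIV. (\<Sum>a\<in>UNIV. G p $ a $ b * matrix_inv (G p) $ a $ l) * ?T l)"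
    by (subst sum.swap) (simp only: sum_distrib_left sum_distrib_right)
  also have "\<dots> = 1/2 * ?T b"
    unfolding inv by (simp add: mult_delta_left)
  finally show ?thesis .
qed

text \<open>The algebraic part of \<open>cov_deriv\<close>, bilinear in the two vectors and
  separated from the derivatives of components.\<close>

definition christoffel_vec :: "'a \<Rightarrow> real^'n \<Rightarrow> real^'n \<Rightarrow> real^'n" where
  "christoffel_vec p u v = (\<chi> k. \<Sum>i\<in>UNIV. \<Sum>j\<in>UNIV. christoffel c G k i j p * u $ i * v $ j)"

definition dir_deriv :: "real^'n \<Rightarrow> ('a \<Rightarrow> real) \<Rightarrow> 'a \<Rightarrow> real" where
  "dir_deriv u F p = (\<Sum>i\<in>UNIV. u $ i * pderiv_chart c i F p)"

lemma cov_deriv_eq: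
  "cov_deriv c G (\<lambda>_. u) P p = (\<chi> k. dir_deriv u (\<lambda>q. P q $ k) p) + christoffel_vec p u (P p)"
  by (simp add: vec_eq_iff cov_deriv_def dir_deriv_def christoffel_vec_def)

lemma metric_christoffel_vec:
  "metric G p (christoffel_vec p u v) w = (\<Sum>i\<in>UNIV. \<Sum>j\<in>UNIV. \<Sum>b\<in>UNIV.
    (\<Sum>a\<in>UNIV. G p $ a $ b * christoffel c G a i j p) * (u $ i * v $ j * w $ b))"
proof -
  have "metric G p (christoffel_vec p u v) w = (\<Sum>a\<in>UNIV. \<Sum>b\<in>UNIV. \<Sum>i\<in>UNIV. \<Sum>j\<in>UNIV.
      G p $ a $ b * christoffel c G a i j p * (u $ i * v $ j * w $ b))"
    by (simp add: metric_def christoffel_vec_def sum_distrib_left sum_distrib_right mult_ac)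
  also have "\<dots> = (\<Sum>a\<in>UNIV. \<Sum>i\<in>UNIV. \<Sum>j\<in>UNIV. \<Sum>b\<in>UNIV.
      G p $ a $ b * christoffel c G a i j p * (u $ i * v $ j * w $ b))"
    by (rule sum.cong[OF refl], subst sum.swap, rule sum.cong[OF refl], rule sum.swap)
  also have "\<dots> = (\<Sum>i\<in>UNIV. \<Sum>j\<in>UNIV. \<Sum>b\<in>UNIV. \<Sum>a\<in>UNIV.
      G p $ a $ b * christoffel c G a i j p * (u $ i * v $ j * w $ b))"
    by (subst sum.swap, rule sum.cong[OF refl], subst sum.swap, rule sum.cong[OF refl], rule sum.swap)
  finally show ?thesis by (simp add: sum_distrib_right)
qed

lemma metric_christoffel_vec_sum:
  assumes "p \<in> cdom c"
  shows "metric G p (christoffel_vec p u v) w + metric G p v (christoffel_vec p u w)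
    = (\<Sum>i\<in>UNIV. u $ i * (\<Sum>a\<in>UNIV. \<Sum>b\<in>UNIV. pderiv_chart c i (\<lambda>q. G q $ a $ b) p * v $ a * w $ b))"
proof -
  let ?L = "\<lambda>i a b. 1/2 * (pderiv_chart c i (\<lambda>q. G q $ a $ b) p + pderiv_chart c a (\<lambda>q. G q $ i $ b) p
      - pderiv_chart c b (\<lambda>q. G q $ i $ a) p)"
  have sym: "pderiv_chart c i (\<lambda>q. G q $ b $ a) p = pderiv_chart c i (\<lambda>q. G q $ a $ b) p" for i a b
    by (rule pderiv_chart_cong[OF assms])
      (auto simp: G_nth_commute differentiable_in_chart_smooth G_smooth assms)
  have "metric G p v (christoffel_vec p u w) = (\<Sum>i\<in>UNIV. \<Sum>b\<in>UNIV. \<Sum>a\<in>UNIV. ?L i b a * (u $ i * w $ b * v $ a))"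
    unfolding G_metric_commute[OF assms, of v "christoffel_vec p u w"] metric_christoffel_vec
      christoffel_lower[OF assms] ..
  also have "\<dots> = (\<Sum>i\<in>UNIV. \<Sum>a\<in>UNIV. \<Sum>b\<in>UNIV. ?L i b a * (u $ i * w $ b * v $ a))"
    by (rule sum.cong[OF refl], rule sum.swap)
  finally have "metric G p (christoffel_vec p u v) w + metric G p v (christoffel_vec p u w)
      = (\<Sum>i\<in>UNIV. \<Sum>a\<in>UNIV. \<Sum>b\<in>UNIV. ?L i a b * (u $ i * v $ a * w $ b) + ?L i b a * (u $ i * w $ b * v $ a))"
    using metric_christoffel_vec christoffel_lower[OF assms] by (simp only: sum.distrib)
  also have "\<dots> = (\<Sum>i\<in>UNIV. \<Sum>a\<in>UNIV. \<Sum>b\<in>UNIV. u $ i * (pderiv_chart c i (\<lambda>q. G q $ a $ b) p * v $ a * w $ b))"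
  proof (intro sum.cong refl)
    fix i a b
    \<comment> \<open>The derivatives in directions \<open>a\<close> and \<open>b\<close> cancel and
      the two halves of the derivative in direction \<open>i\<close> add up. In coordinates this
      says that the metric is parallel.\<close>
    have "?L i a b + ?L i b a = pderiv_chart c i (\<lambda>q. G q $ a $ b) p"
      by (simp add: sym[of i b a] field_simps)
    moreover have "l * (x * y * z) + m * (x * z * y) = x * (d * y * z)" if "l + m = d" for l m d x y z :: real
      using that[symmetric] by (simp add: algebra_simps)
    ultimately show "?L i a b * (u $ i * v $ a * w $ b) + ?L i b a * (u $ i * w $ b * v $ a)
        = u $ i * (pderiv_chart c i (\<lambda>q. G q $ a $ b) p * v $ a * w $ b)"
      by blast
  qed
  finally show ?thesis by (simp only: sum_distrib_left)
qed

text \<open>The product rule yields three sums. Two contain derivatives of the components of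
  \<open>P\<close> and \<open>Q\<close>; the third, with the derivative of the metric, is exactly
  what the Christoffel terms of the two covariant derivatives contribute.\<close>

lemma metric_compatibility:
  assumes "p \<in> cdom c"
    and P: "\<And>k. differentiable_in_chart c (\<lambda>q. P q $ k) p"
    and Q: "\<And>k. differentiable_in_chart c (\<lambda>q. Q q $ k) p"
  shows "dir_deriv u (\<lambda>q. metric G q (P q) (Q q)) p
    = metric G p (cov_deriv c G (\<lambda>_. u) P p) (Q p) + metric G p (P p) (cov_deriv c G (\<lambda>_. u) Q p)"
proof -
  note d = differentiable_in_chart_smooth[OF G_smooth assms(1)] P Q differentiable_in_chart_intros
    differentiable_in_chart_sum
  let ?p = "\<lambda>i a b. pderiv_chart c i (\<lambda>q. G q $ a $ b) p * P p $ a * Q p $ b"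
  have "pderiv_chart c i (\<lambda>q. metric G q (P q) (Q q)) p = (\<Sum>a\<in>UNIV. \<Sum>b\<in>UNIV.
      ?p i a b + (G p $ a $ b * pderiv_chart c i (\<lambda>q. P q $ a) p * Q p $ b
      + G p $ a $ b * P p $ a * pderiv_chart c i (\<lambda>q. Q q $ b) p))" for i
    unfolding metric_def
    by (simp add: pderiv_chart_sum pderiv_chart_mult[OF assms(1)] d) (simp add: algebra_simps)
  then have "dir_deriv u (\<lambda>q. metric G q (P q) (Q q)) p = (\<Sum>i\<in>UNIV. u $ i * (\<Sum>a\<in>UNIV. \<Sum>b\<in>UNIV. ?p i a b))
      + (\<Sum>i\<in>UNIV. \<Sum>a\<in>UNIV. \<Sum>b\<in>UNIV. u $ i * (G p $ a $ b * pderiv_chart c i (\<lambda>q. P q $ a) p * Q p $ b))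
      + (\<Sum>i\<in>UNIV. \<Sum>a\<in>UNIV. \<Sum>b\<in>UNIV. u $ i * (G p $ a $ b * P p $ a * pderiv_chart c i (\<lambda>q. Q q $ b) p))"
    by (simp only: dir_deriv_def sum.distrib distrib_left sum_distrib_left add.assoc)
  also have "(\<Sum>i\<in>UNIV. \<Sum>a\<in>UNIV. \<Sum>b\<in>UNIV. u $ i * (G p $ a $ b * pderiv_chart c i (\<lambda>q. P q $ a) p * Q p $ b))
      = metric G p (\<chi> k. dir_deriv u (\<lambda>q. P q $ k) p) (Q p)"
    unfolding metric_def dir_deriv_def
    by (subst sum.swap, rule sum.cong[OF refl], subst sum.swap, rule sum.cong[OF refl])
      (simp add: sum_distrib_left sum_distrib_right mult_ac)
  also have "(\<Sum>i\<in>UNIV. \<Sum>a\<in>UNIV. \<Sum>b\<in>UNIV. u $ i * (G p $ a $ b * P p $ a * pderiv_chart c i (\<lambda>q. Q q $ b) p))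
      = metric G p (P p) (\<chi> k. dir_deriv u (\<lambda>q. Q q $ k) p)"
    unfolding metric_def dir_deriv_def
    by (subst sum.swap, rule sum.cong[OF refl], subst sum.swap, rule sum.cong[OF refl])
      (simp add: sum_distrib_left sum_distrib_right mult_ac)
  finally show ?thesis
    using metric_christoffel_vec_sum[OF assms(1), of u "P p" "Q p"]
    by (simp add: cov_deriv_eq metric_linear_simps)
qed

lemma differentiable_in_chart_cov_deriv_const:
  assumes "p \<in> cdom c"
  shows "differentiable_in_chart c (\<lambda>q. cov_deriv c G (\<lambda>_. u) (\<lambda>_. w) q $ k) p"
  by (simp add: cov_deriv_def)
    (intro differentiable_in_chart_intros differentiable_in_chart_sum differentiable_in_chart_christoffel assms)

lemma differentiable_in_chart_metric:
  assumes "p \<in> cdom c"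
    and "\<And>k. differentiable_in_chart c (\<lambda>q. P q $ k) p"
    and "\<And>k. differentiable_in_chart c (\<lambda>q. Q q $ k) p"
  shows "differentiable_in_chart c (\<lambda>q. metric G q (P q) (Q q)) p"
  unfolding metric_def
  by (intro differentiable_in_chart_intros differentiable_in_chart_sum assms
      differentiable_in_chart_smooth[OF G_smooth])

lemma smooth_in_chart_metric_const: "smooth_in_chart c (\<lambda>q. metric G q u v)"
  unfolding smooth_in_chart_def smooth_on_def comp_def metric_def
  by (intro allI Ck_on_sum Ck_on_mult Ck_on_const open_chart_image)
    (use G_smooth in \<open>simp add: smooth_in_chart_def smooth_on_def comp_def\<close>)

text \<open>The directions have constant components, so no derivative of \<open>u\<close> or
  \<open>v\<close> arises and the claim reduces to the symmetry of second partial
  derivatives.\<close>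

lemma dir_deriv_commute:
  assumes "smooth_in_chart c F" "p \<in> cdom c"
  shows "dir_deriv u (dir_deriv v F) p = dir_deriv v (dir_deriv u F) p"
proof -
  have expand: "dir_deriv u (dir_deriv v F) p
      = (\<Sum>i\<in>UNIV. \<Sum>j\<in>UNIV. u $ i * (v $ j * pderiv_chart c i (pderiv_chart c j F) p))" for u v
    by (simp add: dir_deriv_def[abs_def] pderiv_chart_sum pderiv_chart_mult[OF assms(2)] assms
        differentiable_in_chart_pderiv_chart differentiable_in_chart_intros sum_distrib_left)
  show ?thesis
    unfolding expand
    by (subst sum.swap, intro sum.cong refl) (simp add: pderiv_chart_commute[OF assms] mult_ac)
qed

text \<open>Metric compatibility applied twice expresses the second derivative of \<open>g(w, z)\<close> along \<open>u\<close>
  and \<open>v\<close>; antisymmetrising in \<open>u\<close> and \<open>v\<close> leaves only the curvature terms.\<close>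

lemma riemann4_skew:
  assumes "p \<in> cdom c"
  shows "riemann4 c G p u v w z = - riemann4 c G p u v z w"
proof -
  let ?N = "\<lambda>v w. cov_deriv c G (\<lambda>_. v) (\<lambda>_. w)"
  note cd = differentiable_in_chart_cov_deriv_const differentiable_in_chart_intros(1)
  \<comment> \<open>Stated at every point of the domain rather than only at \<open>p\<close>,
    because both sides are differentiated again.\<close>
  have first: "dir_deriv v (\<lambda>q. metric G q w z) q = metric G q (?N v w q) z + metric G q w (?N v z q)"
    if "q \<in> cdom c" for q v
    by (rule metric_compatibility[OF that, of "\<lambda>_. w" "\<lambda>_. z" v]; rule differentiable_in_chart_intros(1))
  have second: "dir_deriv u (dir_deriv v (\<lambda>q. metric G q w z)) p
      = metric G p (cov_deriv c G (\<lambda>_. u) (?N v w) p) z + metric G p (?N v w p) (?N u z p)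
        + (metric G p (?N u w p) (?N v z p) + metric G p w (cov_deriv c G (\<lambda>_. u) (?N v z) p))" for u v
  proof -
    have d: "differentiable_in_chart c (\<lambda>q. metric G q (?N v w q) z) p"
        "differentiable_in_chart c (\<lambda>q. metric G q w (?N v z q)) p"
      by (intro differentiable_in_chart_metric[OF assms] cd assms)+
    have "pderiv_chart c i (\<lambda>q. metric G q (?N v w q) z + metric G q w (?N v z q)) p
        = pderiv_chart c i (dir_deriv v (\<lambda>q. metric G q w z)) p" for i
      by (rule pderiv_chart_cong[OF assms])
        (use first differentiable_in_chart_intros(2)[OF d] in auto)
    then have "dir_deriv u (dir_deriv v (\<lambda>q. metric G q w z)) p
        = dir_deriv u (\<lambda>q. metric G q (?N v w q) z) p + dir_deriv u (\<lambda>q. metric G q w (?N v z q)) p"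
      unfolding dir_deriv_def[of u]
      by (simp add: pderiv_chart_add[OF d, symmetric] distrib_left[symmetric] sum.distrib[symmetric])
    moreover have "dir_deriv u (\<lambda>q. metric G q (?N v w q) z) p
        = metric G p (cov_deriv c G (\<lambda>_. u) (?N v w) p) z + metric G p (?N v w p) (?N u z p)"
      by (rule metric_compatibility[OF assms, of "?N v w" "\<lambda>_. z" u]; intro cd assms)
    moreover have "dir_deriv u (\<lambda>q. metric G q w (?N v z q)) p
        = metric G p (?N u w p) (?N v z p) + metric G p w (cov_deriv c G (\<lambda>_. u) (?N v z) p)"
      by (rule metric_compatibility[OF assms, of "\<lambda>_. w" "?N v z" u]; intro cd assms)
    ultimately show ?thesis by (simp only:)
  qed
  \<comment> \<open>Fields with constant components have vanishing Lie bracket, which removes the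
    third term of the curvature operator.\<close>
  have riem: "riemann c G p u v w = cov_deriv c G (\<lambda>_. u) (?N v w) p - cov_deriv c G (\<lambda>_. v) (?N u w) p" for w
    by (simp add: riemann_def curvature_operator_def lie_bracket_def[abs_def] vec_eq_iff)
      (simp add: cov_deriv_def)
  have "dir_deriv u (dir_deriv v (\<lambda>q. metric G q w z)) p = dir_deriv v (dir_deriv u (\<lambda>q. metric G q w z)) p"
    by (rule dir_deriv_commute[OF smooth_in_chart_metric_const assms])
  then show ?thesis
    unfolding riemann4_def riem second metric_linear_simps
      G_metric_commute[OF assms, of "cov_deriv c G _ _ _" w]
    by linarith
qed

end

end

section \<open>Contraction of the conharmonic tensor\<close>

text \<open>Take determinants in the normal form: the diagonal matrix has entries 1 and -1, so no
  factor on the other side can be singular.\<close>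

lemma lorentzian_matrix_invertible:
  assumes "lorentzian_matrix G"
  shows "invertible G"
proof -
  obtain P :: "real^'a^'a" and i\<^sub>0 where P: "transpose P ** G ** P
      = (\<chi> i j. if i = j then (if i = i\<^sub>0 then - 1 else 1) else 0)" (is "_ = ?D")
    using assms unfolding lorentzian_matrix_def by blast
  have "det ?D = (\<Prod>i\<in>UNIV. ?D $ i $ i)"
    by (rule det_diagonal) simp
  then have "det ?D \<noteq> 0" by simp
  moreover have "det ?D = det (transpose P) * det G * det P"
    unfolding P[symmetric] det_mul ..
  ultimately have "det G \<noteq> 0" by auto
  then show ?thesis by (simp add: invertible_det_nz)
qed

lemma metric_axis: "metric G p (axis i 1) v = (G p *v v) $ i"
  by (simp add: metric_eq_inner inner_commute[of "axis i 1"] inner_axis)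

lemma sum_metric_axis: "(\<Sum>i\<in>UNIV. metric G p (axis i 1) v * w $ i) = metric G p w v"
  by (simp add: metric_axis metric_eq_inner[of _ _ w] inner_vec_def mult.commute)

text \<open>Every vector is \<open>G p\<close> applied to some vector, so the difference is
  orthogonal to everything, itself included. This gives uniqueness for the description in
  \<open>conharmonic\<close>.\<close>

lemma metric_nondegenerate:
  assumes "invertible (G p)" "\<And>w. metric G p h w = metric G p h' w"
  shows "h = h'"
proof -
  have "(h - h') \<bullet> y = 0" for y
  proof -
    have "y = G p *v (matrix_inv (G p) *v y)"
      using matrix_inv_right[OF assms(1)] by (simp add: matrix_vector_mul_assoc)
    then show ?thesis
      using assms(2)[of "matrix_inv (G p) *v y"] by (simp add: metric_eq_inner inner_diff_left)
  qed
  from this[of "h - h'"] show ?thesis by simp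
qed

text \<open>The linear algebra at one point, with arbitrary tangent vectors in place of vector
  fields.\<close>

lemma scalar_curvature_zero_at_point:
  fixes c :: "('a, 4) chart" and G :: "'a \<Rightarrow> real^4^4" and p :: 'a
  defines "m \<equiv> metric G p" and "S \<equiv> ricci c G p"
  assumes sym: "transpose (G p) = G p" and inv: "invertible (G p)" and "\<beta> \<noteq> 0"
    and norms: "m \<xi>\<^sub>1 \<xi>\<^sub>1 = - 1" "m \<xi>\<^sub>2 \<xi>\<^sub>2 = 1" "m \<xi>\<^sub>1 \<xi>\<^sub>2 = 0"
    and S: "\<And>u v. S u v = \<alpha> * m u v + \<beta> * (m u \<xi>\<^sub>1 * m v \<xi>\<^sub>2 + m v \<xi>\<^sub>1 * m u \<xi>\<^sub>2)"
    and skew: "\<And>x y z w. riemann4 c G p x y z w = - riemann4 c G p x y w z"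
    and HS: "\<And>x y z w. S (conharmonic c G p x y z) w + S z (conharmonic c G p x y w) = 0"
  shows "scalar_curvature c G p = 0"
proof -
  let ?R = "riemann c G p" and ?C = "conharmonic c G p" and ?H = "conharmonic4 c G p"
  have m_commute: "m u v = m v u" for u v
    unfolding m_def by (rule metric_commute) (rule sym)
  note m_linear = metric_linear_simps[of G p, folded m_def]
  have m21: "m \<xi>\<^sub>2 \<xi>\<^sub>1 = 0" using norms(3) m_commute by simp
  \<comment> \<open>The Ricci operator, that is, \<open>S\<close> with one index raised.\<close>
  define Q where "Q x = \<alpha> *\<^sub>R x + \<beta> *\<^sub>R (m x \<xi>\<^sub>1 *\<^sub>R \<xi>\<^sub>2 + m x \<xi>\<^sub>2 *\<^sub>R \<xi>\<^sub>1)" for x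
  have mQ: "m (Q x) w = S x w" for x w
    by (simp add: Q_def S m_linear m_commute[of _ w] algebra_simps)
  \<comment> \<open>Raising the last index of \<open>?H\<close> term by term gives an explicit
    witness for the definite description in \<open>conharmonic\<close>; its components can then be
    traced.\<close>
  define h where "h x y z = ?R x y z - (1/2) *\<^sub>R (S y z *\<^sub>R x - m x z *\<^sub>R Q y + m y z *\<^sub>R Q x - S x z *\<^sub>R y)"
    for x y z
  have m_h: "m (h x y z) w = ?H x y z w" for x y z w
    unfolding h_def conharmonic4_def riemann4_def m_def[symmetric] S_def[symmetric] m_linear mQ
    by (simp add: mult.commute)
  have C: "?C x y z = h x y z" for x y z
    unfolding conharmonic_def
  proof (rule the_equality)
    show "\<forall>w. metric G p (h x y z) w = ?H x y z w"
      using m_h by (simp add: m_def)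
    show "h' = h x y z" if "\<forall>w. metric G p h' w = ?H x y z w" for h'
      by (rule metric_nondegenerate[of G p, OF inv]) (use that m_h in \<open>simp add: m_def\<close>)
  qed
  have H_skew: "?H x y z w = - ?H x y w z" for x y z w
    unfolding conharmonic4_def skew[of x y z w] by (simp add: algebra_simps)
  have E: "?H x y z \<xi>\<^sub>1 * m w \<xi>\<^sub>2 + m w \<xi>\<^sub>1 * ?H x y z \<xi>\<^sub>2 + m z \<xi>\<^sub>1 * ?H x y w \<xi>\<^sub>2
      + ?H x y w \<xi>\<^sub>1 * m z \<xi>\<^sub>2 = 0" (is "?e = 0") for x y z w
  proof -
    have "S (?C x y z) w + S z (?C x y w) = \<alpha> * (?H x y z w + ?H x y w z) + \<beta> * ?e"
      unfolding S C m_commute[of z "h x y w"] m_h by (simp add: algebra_simps)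
    then show ?thesis
      using HS[of x y z w] H_skew[of x y z w] \<open>\<beta> \<noteq> 0\<close> by simp
  qed
  have H12: "?H x y \<xi>\<^sub>1 \<xi>\<^sub>2 = 0" for x y
    using E[of x y \<xi>\<^sub>1 \<xi>\<^sub>1] norms by simp
  \<comment> \<open>In \<open>E\<close> with \<open>z = \<xi>\<^sub>1\<close> the first term
    vanishes by skewness, the second by \<open>H12\<close> and the fourth by orthogonality. The
    third is \<open>- ?H x y w \<xi>\<^sub>2\<close>.\<close>
  have "?H x y w \<xi>\<^sub>2 = 0" for x y w
    using E[of x y \<xi>\<^sub>1 w] H12[of x y] H_skew[of x y \<xi>\<^sub>1 \<xi>\<^sub>1] norms by simp
  then have "?H x y \<xi>\<^sub>2 w = 0" for x y w
    using H_skew[of x y \<xi>\<^sub>2 w] by simp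
  then have h0: "h x y \<xi>\<^sub>2 = 0" for x y
    using m_h by (intro metric_nondegenerate[of G p, OF inv]) (simp add: m_def metric_eq_inner)
  have S22: "S \<xi>\<^sub>2 \<xi>\<^sub>2 = \<alpha>"
    by (simp add: S norms m21)
  \<comment> \<open>The trace of the rank-one map sending \<open>x\<close> to
    \<open>m x v *\<^sub>R w\<close>. The operators in \<open>h\<close> other than the curvature are
    combinations of such maps and the identity.\<close>
  have tr_m: "(\<Sum>i\<in>UNIV. m (axis i 1) v * w $ i) = m w v" for v w
    unfolding m_def by (rule sum_metric_axis)
  have tr_id: "(\<Sum>i\<in>UNIV. (axis i 1 :: real^4) $ i) = 4"
    by simp
  have tr_Q: "(\<Sum>i\<in>UNIV. Q (axis i 1) $ i) = 4 * \<alpha>"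
  proof -
    have "(\<Sum>i\<in>UNIV. Q (axis i 1) $ i) = \<alpha> * (\<Sum>i\<in>UNIV. (axis i 1 :: real^4) $ i)
        + \<beta> * ((\<Sum>i\<in>UNIV. m (axis i 1) \<xi>\<^sub>1 * \<xi>\<^sub>2 $ i) + (\<Sum>i\<in>UNIV. m (axis i 1) \<xi>\<^sub>2 * \<xi>\<^sub>1 $ i))"
      by (simp add: Q_def sum.distrib sum_distrib_left distrib_left)
    then show ?thesis unfolding tr_m tr_id using norms m21 by simp
  qed
  have tr_S: "(\<Sum>i\<in>UNIV. S (axis i 1) \<xi>\<^sub>2 * \<xi>\<^sub>2 $ i) = \<alpha>"
  proof -
    have "(\<Sum>i\<in>UNIV. S (axis i 1) \<xi>\<^sub>2 * \<xi>\<^sub>2 $ i) = \<alpha> * (\<Sum>i\<in>UNIV. m (axis i 1) \<xi>\<^sub>2 * \<xi>\<^sub>2 $ i)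
        + \<beta> * (\<Sum>i\<in>UNIV. m (axis i 1) \<xi>\<^sub>1 * \<xi>\<^sub>2 $ i)"
      by (simp add: S norms m21 sum.distrib sum_distrib_left algebra_simps)
    then show ?thesis unfolding tr_m using norms m21 by simp
  qed
  have tr_R: "(\<Sum>i\<in>UNIV. ?R (axis i 1) y z $ i) = S y z" for y z
    by (simp add: S_def ricci_def trace_def matrix_def)
  \<comment> \<open>The trace over the first argument evaluates to \<open>\<alpha> - (4 * \<alpha> -
    \<alpha> + 4 * \<alpha> - \<alpha>) / 2\<close>, which is \<open>- 2 * \<alpha>\<close>.\<close>
  have "0 = (\<Sum>i\<in>UNIV. h (axis i 1) \<xi>\<^sub>2 \<xi>\<^sub>2 $ i)"
    by (simp add: h0)
  also have "\<dots> = (\<Sum>i\<in>UNIV. ?R (axis i 1) \<xi>\<^sub>2 \<xi>\<^sub>2 $ i) - (1/2) * (\<alpha> * (\<Sum>i\<in>UNIV. (axis i 1 :: real^4) $ i)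
      - (\<Sum>i\<in>UNIV. m (axis i 1) \<xi>\<^sub>2 * Q \<xi>\<^sub>2 $ i) + (\<Sum>i\<in>UNIV. Q (axis i 1) $ i)
      - (\<Sum>i\<in>UNIV. S (axis i 1) \<xi>\<^sub>2 * \<xi>\<^sub>2 $ i))"
    unfolding h_def
    by (simp only: vector_minus_component vector_add_component vector_scaleR_component S22 norms
        real_scaleR_def sum.distrib sum_subtractf sum_distrib_left mult_1_left distrib_left right_diff_distrib)
  also have "\<dots> = - 2 * \<alpha>"
    unfolding tr_R tr_id tr_m tr_Q tr_S mQ S22 by simp
  finally have "\<alpha> = 0" by simp
  let ?I = "matrix_inv (G p)"
  \<comment> \<open>The inverse metric pairs the one-forms dual to \<open>u\<close> and
    \<open>v\<close> to the inner product of these vectors.\<close>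
  have contract: "(\<Sum>i\<in>UNIV. \<Sum>j\<in>UNIV. ?I $ i $ j * (m (axis i 1) u * m (axis j 1) v)) = m v u" for u v
  proof -
    have "(\<Sum>i\<in>UNIV. \<Sum>j\<in>UNIV. ?I $ i $ j * (m (axis i 1) u * m (axis j 1) v))
        = (G p *v u) \<bullet> (?I *v (G p *v v))"
      by (simp add: m_def metric_axis inner_vec_def matrix_vector_mult_def[of ?I] sum_distrib_left mult_ac)
    also have "?I *v (G p *v v) = v"
      using matrix_inv_left[OF inv] by (simp add: matrix_vector_mul_assoc)
    finally show ?thesis by (simp add: m_def metric_eq_inner inner_commute)
  qed
  \<comment> \<open>Once \<open>\<alpha> = 0\<close>, only the mixed part of \<open>S\<close>
    remains, and it contracts to multiples of \<open>m \<xi>\<^sub>1 \<xi>\<^sub>2\<close> and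
    \<open>m \<xi>\<^sub>2 \<xi>\<^sub>1\<close>, both zero.\<close>
  have "scalar_curvature c G p
      = \<beta> * ((\<Sum>i\<in>UNIV. \<Sum>j\<in>UNIV. ?I $ i $ j * (m (axis i 1) \<xi>\<^sub>1 * m (axis j 1) \<xi>\<^sub>2))
        + (\<Sum>i\<in>UNIV. \<Sum>j\<in>UNIV. ?I $ i $ j * (m (axis i 1) \<xi>\<^sub>2 * m (axis j 1) \<xi>\<^sub>1)))"
    unfolding scalar_curvature_def S_def[symmetric] S \<open>\<alpha> = 0\<close>
    by (simp add: sum.distrib sum_distrib_left algebra_simps)
  then show ?thesis
    unfolding contract using norms m21 by simp
qed

section \<open>Passage from global vector fields to tangent vectors at a point\<close>

theorem theorem6p1:
  fixes M :: "'a topology"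
    and \<A> :: "('a, 4) chart set"
    and g :: "('a, 4) chart \<Rightarrow> 'a \<Rightarrow> real^4^4"
  assumes "mixed_quasi_einstein_spacetime M \<A> g"
    and "conharmonic_dot_ricci_zero \<A> g"
  shows "\<forall>c\<in>\<A>. \<forall>p\<in>cdom c. scalar_curvature c (g c) p = 0"
proof (intro ballI)
  fix c p assume c: "c \<in> \<A>" and p: "p \<in> cdom c"
  have mfd: "smooth_manifold M \<A>" and metric: "lorentzian_metric \<A> g"
    using assms(1) by (auto simp: mixed_quasi_einstein_spacetime_def lorentzian_manifold_def)
  obtain \<alpha> \<beta> :: "'a \<Rightarrow> real" and \<xi>\<^sub>1 \<xi>\<^sub>2 where \<beta>: "\<forall>p\<in>topspace M. \<beta> p \<noteq> 0"
    and \<xi>: "\<forall>c\<in>\<A>. \<forall>p\<in>cdom c. metric (g c) p (\<xi>\<^sub>1 c p) (\<xi>\<^sub>1 c p) = - 1 \<and>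
           metric (g c) p (\<xi>\<^sub>2 c p) (\<xi>\<^sub>2 c p) = 1 \<and> metric (g c) p (\<xi>\<^sub>1 c p) (\<xi>\<^sub>2 c p) = 0"
    and S: "\<forall>X Y. vector_field \<A> X \<longrightarrow> vector_field \<A> Y \<longrightarrow> (\<forall>c\<in>\<A>. \<forall>p\<in>cdom c.
              ricci c (g c) p (X c p) (Y c p) = \<alpha> p * metric (g c) p (X c p) (Y c p) +
                \<beta> p * (metric (g c) p (X c p) (\<xi>\<^sub>1 c p) * metric (g c) p (Y c p) (\<xi>\<^sub>2 c p)
                  + metric (g c) p (Y c p) (\<xi>\<^sub>1 c p) * metric (g c) p (X c p) (\<xi>\<^sub>2 c p)))"
    using assms(1) unfolding mixed_quasi_einstein_spacetime_def Let_def by blast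
  note extend = vector_field_extension[OF mfd c p]
  have lor: "lorentzian_matrix (g c q)" if "q \<in> cdom c" for q
    using metric c that unfolding lorentzian_metric_def by blast
  have smooth: "smooth_in_chart c (\<lambda>q. g c q $ i $ j)" for i j
    using metric c unfolding lorentzian_metric_def by blast
  have sym: "transpose (g c q) = g c q" if "q \<in> cdom c" for q
    using lor[OF that] by (simp add: lorentzian_matrix_def)
  have inv: "invertible (g c q)" if "q \<in> cdom c" for q
    using lor[OF that] by (rule lorentzian_matrix_invertible)
  show "scalar_curvature c (g c) p = 0"
  proof (rule scalar_curvature_zero_at_point)
    show "transpose (g c p) = g c p" "invertible (g c p)"
      using p sym inv by blast+
    have "p \<in> topspace M"
      using c p mfd by (auto simp: smooth_manifold_def)
    then show "\<beta> p \<noteq> 0" using \<beta> by blast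
    show "metric (g c) p (\<xi>\<^sub>1 c p) (\<xi>\<^sub>1 c p) = - 1" "metric (g c) p (\<xi>\<^sub>2 c p) (\<xi>\<^sub>2 c p) = 1"
        "metric (g c) p (\<xi>\<^sub>1 c p) (\<xi>\<^sub>2 c p) = 0"
      using \<xi> c p by auto
    show "ricci c (g c) p u v = \<alpha> p * metric (g c) p u v +
        \<beta> p * (metric (g c) p u (\<xi>\<^sub>1 c p) * metric (g c) p v (\<xi>\<^sub>2 c p)
          + metric (g c) p v (\<xi>\<^sub>1 c p) * metric (g c) p u (\<xi>\<^sub>2 c p))" for u v
    proof -
      obtain X where X: "vector_field \<A> X" "X c p = u" by (rule extend)
      obtain Y where Y: "vector_field \<A> Y" "Y c p = v" by (rule extend)
      show ?thesis using S[rule_format, OF X(1) Y(1) c p] unfolding X(2) Y(2) .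
    qed
    show "riemann4 c (g c) p x y z w = - riemann4 c (g c) p x y w z" for x y z w
      by (rule riemann4_skew[OF chart_onI[OF mfd c] smooth sym inv p])
    show "ricci c (g c) p (conharmonic c (g c) p x y z) w + ricci c (g c) p z (conharmonic c (g c) p x y w) = 0"
      for x y z w
    proof -
      obtain X where X: "vector_field \<A> X" "X c p = x" by (rule extend)
      obtain Y where Y: "vector_field \<A> Y" "Y c p = y" by (rule extend)
      obtain Z where Z: "vector_field \<A> Z" "Z c p = z" by (rule extend)
      obtain W where W: "vector_field \<A> W" "W c p = w" by (rule extend)
      show ?thesis
        using assms(2)[unfolded conharmonic_dot_ricci_zero_def, rule_format, OF X(1) Y(1) Z(1) W(1) c p]
        unfolding X(2) Y(2) Z(2) W(2) .
    qed
  qed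
qed

end
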